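(* Let $\bm Z = (\bm X_i, f(\bm X_i))_{i=1}^n$ with $\bm X_1,\dots,\bm X_n$ independent and identically distributed according to $\rho$ on $\Omega$, and let $R_h$ be a reconstruction method. Let $$M = \sup_{\bm x_1,\dots,\bm x_{n-1}\in\Omega} \|R_h((\bm x_i, f(\bm x_i))_{i=1}^{n-1})\|_\infty$$ be a uniform bound on the reconstruction for arbitrary nodes. Let $\Xi=\Xi(h,C_1,C_2)\subseteq(\Omega\times Y)^n$ be the set of admissible samples (defined in the context), and let $\gamma = 1-\mathbb P\{\bm Z\in\Xi\}$. Then for every $\varepsilon > 2\gamma\max\{4nC_1C_2+C_1^2,\ (M+\|f\|_\infty)^2\}$, \begin{align*} \mathbb P\left\{\left|\mathrm{CV}(\bm Z,h)-\mathcal E(R_h(\bm Z_{-1}))\right|>\varepsilon\right\} &\le 2\gamma+2\exp\left(-\left(\frac{\varepsilon}{\sqrt2\,C_1(C_1/\sqrt n+4\sqrt n\,C_2)}-\sqrt{2n}\,\gamma\right)^2\right)\\ &\le 2\gamma+2\exp\left(-\left(\frac{\varepsilon}{12\sqrt n\,C_1^2}-\sqrt{2n}\,\gamma\right)^2\right), \end{align*} where the second inequality holds for $n\ge 3$. In particular, for $0<\delta\le 1$, with probability larger than $1-2(\gamma+\delta)$, \begin{align*} |\mathrm{CV}(\bm Z,h)-\mathcal E(R_h(\bm Z_{-1}))| &\le\max\left\{2\gamma(M+\|f\|_\infty)^2,\ \sqrt2\,C_1\left(\frac{C_1}{\sqrt n}+4\sqrt n\,C_2\right)\left(\sqrt{2n}\,\gamma+\sqrt{-\log\delta}\right)\right\}\\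 &\le\max\left\{2\gamma(M+\|f\|_\infty)^2,\ 12\sqrt n\,C_1^2\left(\sqrt{2n}\,\gamma+\sqrt{-\log\delta}\right)\right\}, \end{align*} where the second of these inequalities again refers to $n\ge3$.
   Context: $(\Omega,\rho)$ is a probability space, $Y\subseteq\mathbb C$ is a set of values with absolute value $|\cdot|$, and $f\colon\Omega\to Y$ is the function to be approximated. A reconstruction method $R_h$ assigns to a finite list of samples in $\Omega\times Y$ (here lists of length $n-1$) a function $\Omega\to Y$; $h$ is a label for the method/parameter. $\|g\|_\infty=\sup_{\bm x\in\Omega}|g(\bm x)|$. All functions and sets are tacitly assumed measurable where needed. For $\bm z=(z_1,\dots,z_n)\in(\Omega\times Y)^n$ with nodes $\bm x_1,\dots,\bm x_n$, put $\bm z_{-i}=(z_1,\dots,z_{i-1},z_{i+1},\dots,z_n)$. Risk functional: $\mathcal E(g)=\int_\Omega|g(\bm x)-f(\bm x)|^2\,\mathrm d\rho(\bm x)$ for $g\colon\Omega\to Y$. Leave-one-out cross-validation score: $\mathrm{CV}(\bm z,h)=\frac1n\sum_{i=1}^n|R_h(\bm z_{-i})(\bm x_i)-f(\bm x_i)|^2$. Set of admissible samples: for constants $C_1,C_2>0$ with $C_2\le 2C_1$, $\Xi=\Xi(h,C_1,C_2)\subseteq(\Omega\times Y)^n$ denotes a set of samples for which (i) $\|R_h(\bm z_{-i})-f\|_\infty<C_1$ for all $\bm z\in\Xi$ and $1\le i\le n$; (ii) for every $\bm x\in\Omega$ and $1\le i\le n$ the map $\bm z_{-i}\mapsto R_h(\bm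 z_{-i})(\bm x)$ is $C_2\mathbf 1$-bounded on $\Xi$, i.e. $|R_h(\bm z_{-i})(\bm x)-R_h(\bm z'_{-i})(\bm x)|\le C_2\cdot\#\{j\ne i: z_j\ne z_j'\}$ for all $\bm z,\bm z'\in\Xi$.
   Formalization: The second inequality of the first display is asserted only when minus its bracket (ε/(12√n C₁²) − √(2n)γ) is at most the first bound's bracket; otherwise it is false as printed (e.g. f = R = 0, n = 100, C₁ = 1, C₂ = 1/400, γ = 0.1, ε = 0.41). *)

theory Defs
  imports "HOL-Probability.Probability"
begin

text \<open>
  Samples \<open>z = (z\<^sub>1, \<dots>, z\<^sub>n)\<close> in \<open>(\<Omega> \<times> Y)\<^sup>n\<close> are functions in \<open>{1..n} \<rightarrow>\<^sub>E \<Omega> \<times> Y\<close>.  A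
  reconstruction method takes a list of samples; \<open>R h\<close> is the method with label \<open>h\<close>.
\<close>

type_synonym ('h, 'a) reconstruction = "'h \<Rightarrow> ('a \<times> complex) list \<Rightarrow> 'a \<Rightarrow> complex"

definition leave_out :: "nat \<Rightarrow> (nat \<Rightarrow> 'b) \<Rightarrow> nat \<Rightarrow> 'b list" where
  "leave_out n z i = map z ([1..<i] @ [Suc i..<Suc n])"

definition graph_sample :: "('a \<Rightarrow> complex) \<Rightarrow> nat \<Rightarrow> (nat \<Rightarrow> 'a) \<Rightarrow> nat \<Rightarrow> 'a \<times> complex" where
  "graph_sample f n x = (\<lambda>i\<in>{1..n}. (x i, f (x i)))"

text \<open>The supremum norm is a true supremum, not an essential one, and may be infinite.\<close>

definition sup_norm :: "'a set \<Rightarrow> ('a \<Rightarrow> complex) \<Rightarrow> ennreal" where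
  "sup_norm \<Omega> g = (SUP x\<in>\<Omega>. ennreal (cmod (g x)))"

definition risk :: "'a measure \<Rightarrow> ('a \<Rightarrow> complex) \<Rightarrow> ('a \<Rightarrow> complex) \<Rightarrow> real" where
  "risk \<rho> f g = (\<integral>x. (cmod (g x - f x))\<^sup>2 \<partial>\<rho>)"

definition cv_score ::
  "('a \<Rightarrow> complex) \<Rightarrow> ('h, 'a) reconstruction \<Rightarrow> nat \<Rightarrow> (nat \<Rightarrow> 'a \<times> complex) \<Rightarrow> 'h \<Rightarrow> real" where
  "cv_score f R n z h =
     1 / real n * (\<Sum>i=1..n. (cmod (R h (leave_out n z i) (fst (z i)) - f (fst (z i))))\<^sup>2)"

definition recon_bound ::
  "'a set \<Rightarrow> ('a \<Rightarrow> complex) \<Rightarrow> ('h, 'a) reconstruction \<Rightarrow> nat \<Rightarrow> 'h \<Rightarrow> ennreal" where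
  "recon_bound \<Omega> f R n h =
     (SUP xs\<in>{xs. length xs = n - 1 \<and> set xs \<subseteq> \<Omega>}. sup_norm \<Omega> (R h (map (\<lambda>x. (x, f x)) xs)))"

text \<open>
  A predicate on \<open>\<Xi>\<close>, as (ii) relates pairs of elements of \<open>\<Xi>\<close> and so does not single out one
  (largest) set.
\<close>

definition admissible ::
  "'a set \<Rightarrow> complex set \<Rightarrow> ('a \<Rightarrow> complex) \<Rightarrow> ('h, 'a) reconstruction \<Rightarrow> nat \<Rightarrow> 'h \<Rightarrow>
   real \<Rightarrow> real \<Rightarrow> (nat \<Rightarrow> 'a \<times> complex) set \<Rightarrow> bool" where
  "admissible \<Omega> Y f R n h C1 C2 \<Xi> \<longleftrightarrow>
     \<Xi> \<subseteq> ({1..n} \<rightarrow>\<^sub>E \<Omega> \<times> Y) \<and>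
     (\<forall>z\<in>\<Xi>. \<forall>i\<in>{1..n}. sup_norm \<Omega> (\<lambda>x. R h (leave_out n z i) x - f x) < ennreal C1) \<and>
     (\<forall>x\<in>\<Omega>. \<forall>i\<in>{1..n}. \<forall>z\<in>\<Xi>. \<forall>z'\<in>\<Xi>.
        cmod (R h (leave_out n z i) x - R h (leave_out n z' i) x)
          \<le> C2 * real (card {j \<in> {1..n} - {i}. z j \<noteq> z' j}))"

end

theory Submission
  imports Defs
begin

text \<open>
  The difference \<open>G\<close> of score and risk has mean zero: by exchangeability, each term of the score has
  the expectation of the risk.  On the good set \<open>A\<close> of nodes with admissible sample, \<open>G\<close> is bounded by
  \<open>C1\<^sup>2\<close> and changes by at most \<open>c = C1\<^sup>2 / n + 4 C1 C2\<close> per changed node; everywhere it is bounded by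
  \<open>B = (M + F)\<^sup>2\<close>.  So a version of McDiarmid's inequality is needed for a function with bounded
  differences on \<open>A\<close> only.  The Lipschitz extension of \<open>G\<close> from \<open>A\<close> may be non-measurable.  It is
  avoided by bounding \<open>E (exp (s G); A)\<close> directly, by induction on the coordinates with Hoeffding's
  lemma in each step, in terms of the mean of the function equal to \<open>G\<close> on \<open>A\<close> and to \<open>C1\<^sup>2\<close> off \<open>A\<close>.
  That mean is at most \<open>\<gamma> (B + C1\<^sup>2) \<le> \<epsilon> / 2 + \<gamma> n c\<close>.
\<close>

section \<open>Exponential moments under bounded differences\<close>

text \<open>The hypotheses put \<open>ln \<psi> / s\<close> below \<open>\<phi>\<close> and below
  the infimum of \<open>\<phi>\<close> plus \<open>c\<close>, hence below the truncation
  \<open>g\<close>, whose values lie in an interval of length \<open>c\<close>. Hoeffding's lemma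
  applies to \<open>g\<close>, and the mean of \<open>g\<close> is at most that of
  \<open>\<phi>\<close>. The oscillation of \<open>\<phi>\<close> itself may exceed
  \<open>c\<close>.\<close>

lemma (in prob_space) nn_integral_exp_le_of_oscillation:
  fixes \<phi> :: "'a \<Rightarrow> real" and \<psi> :: "'a \<Rightarrow> ennreal"
  assumes "s > 0" and c: "c \<ge> 0" and \<phi>[measurable]: "\<phi> \<in> borel_measurable M"
    and K: "\<And>x. x \<in> space M \<Longrightarrow> \<bar>\<phi> x\<bar> \<le> K"
    and le: "\<And>x. x \<in> space M \<Longrightarrow> \<psi> x \<le> ennreal (exp (s * \<phi> x))"
    and le_c: "\<And>x y. x \<in> space M \<Longrightarrow> y \<in> space M \<Longrightarrow> \<psi> x \<le> ennreal (exp (s * (\<phi> y + c)))"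
  shows "(\<integral>\<^sup>+x. \<psi> x \<partial>M) \<le> ennreal (exp (s * (\<integral>x. \<phi> x \<partial>M) + s\<^sup>2 * c\<^sup>2 / 8))"
proof -
  define a where "a = (INF y\<in>space M. \<phi> y)"
  define g where "g x = min (\<phi> x) (a + c)" for x
  have bdd: "bdd_below (\<phi> ` space M)"
    by (rule bdd_belowI2[of _ "- K"]) (use K in \<open>force simp: abs_le_iff\<close>)
  have \<psi>_le: "\<psi> x \<le> ennreal (exp (s * g x))" if x: "x \<in> space M" for x
  proof (cases "\<psi> x = 0")
    case False
    define l where "l = ln (enn2real (\<psi> x)) / s"
    have fin: "\<psi> x < top"
      using le[OF x] by (simp add: le_less_trans)
    then have pos: "enn2real (\<psi> x) > 0"
      using False by (simp add: enn2real_positive_iff zero_less_iff_neq_zero)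
    have \<psi>: "\<psi> x = ennreal (exp (s * l))"
      using pos fin \<open>s > 0\<close> by (simp add: l_def)
    have "l \<le> \<phi> y + c" if "y \<in> space M" for y
      using le_c[OF x that] \<open>s > 0\<close> unfolding \<psi> by simp
    then have "l - c \<le> a"
      unfolding a_def using not_empty by (intro cINF_greatest) (auto simp: algebra_simps)
    moreover have "l \<le> \<phi> x"
      using le[OF x] \<open>s > 0\<close> unfolding \<psi> by simp
    ultimately show ?thesis
      unfolding \<psi> g_def using \<open>s > 0\<close> by (intro ennreal_leI) auto
  qed simp
  have int_\<phi>: "integrable M \<phi>"
    by (rule integrable_const_bound[where B = K]) (use K in auto)
  interpret g: interval_bounded_random_variable M g a "a + c"
  proof
    show "g \<in> borel_measurable M"
      unfolding g_def by measurable
    show "AE x in M. g x \<in> {a..a + c}"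
      using c by (intro AE_I2) (auto simp: g_def a_def intro!: cINF_lower bdd)
  qed
  have "(\<integral>\<^sup>+x. \<psi> x \<partial>M) \<le> (\<integral>\<^sup>+x. ennreal (exp (s * expectation g)) * ennreal (exp (s * (g x - expectation g))) \<partial>M)"
    using \<psi>_le by (intro nn_integral_mono) (simp add: ennreal_mult[symmetric] exp_add[symmetric] algebra_simps)
  also have "\<dots> = ennreal (exp (s * expectation g)) * (\<integral>\<^sup>+x. ennreal (exp (s * (g x - expectation g))) \<partial>M)"
    by (rule nn_integral_cmult) (use g.random_variable in measurable)
  also have "\<dots> \<le> ennreal (exp (s * expectation g)) * ennreal (exp (s\<^sup>2 * (a + c - a)\<^sup>2 / 8))"
    by (intro mult_left_mono g.Hoeffdings_lemma_nn_integral \<open>s > 0\<close>) auto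
  also have "\<dots> = ennreal (exp (s * expectation g + s\<^sup>2 * c\<^sup>2 / 8))"
    by (simp add: ennreal_mult[symmetric] exp_add)
  also have "expectation g \<le> expectation \<phi>"
    by (intro integral_mono g.integrable int_\<phi>) (simp add: g_def)
  finally show ?thesis
    using \<open>s > 0\<close> by (simp add: mult_left_mono)
qed


text \<open>
  The function \<open>\<phi>\<close> need not have bounded differences: the hypothesis says that \<open>ln \<psi> / s\<close> lies below
  the largest minorant of \<open>\<phi>\<close> that has them.  This minorant may fail to be measurable; \<open>\<psi>\<close> and \<open>\<phi>\<close>
  are measurable, and the hypothesis survives integrating out one coordinate.
\<close>

lemma nn_integral_exp_le_of_bounded_differences:
  fixes M :: "'i \<Rightarrow> 'a measure" and \<phi> :: "('i \<Rightarrow> 'a) \<Rightarrow> real" and \<psi> :: "('i \<Rightarrow> 'a) \<Rightarrow> ennreal"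
  assumes prob: "\<And>i. prob_space (M i)" and "finite I" and s: "s > 0" and "\<And>i. i \<in> I \<Longrightarrow> c i \<ge> 0"
    and "\<phi> \<in> borel_measurable (PiM I M)" and "\<psi> \<in> borel_measurable (PiM I M)"
    and "\<And>x. x \<in> space (PiM I M) \<Longrightarrow> \<bar>\<phi> x\<bar> \<le> K"
    and "\<And>x y. x \<in> space (PiM I M) \<Longrightarrow> y \<in> space (PiM I M) \<Longrightarrow>
           \<psi> x \<le> ennreal (exp (s * (\<phi> y + sum c {i\<in>I. x i \<noteq> y i})))"
  shows "(\<integral>\<^sup>+x. \<psi> x \<partial>PiM I M) \<le> ennreal (exp (s * (\<integral>x. \<phi> x \<partial>PiM I M) + s\<^sup>2 * (\<Sum>i\<in>I. (c i)\<^sup>2) / 8))"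
  using assms(2,4-)
proof (induction I arbitrary: \<phi> \<psi> rule: finite_induct)
  case empty
  interpret product_prob_space M "{}"
    by (intro product_prob_space.intro product_sigma_finite.intro product_prob_space_axioms.intro
        prob prob_space_imp_sigma_finite)
  have "(\<integral>\<^sup>+x. \<psi> x \<partial>PiM {} M) = \<psi> (\<lambda>_. undefined)"
    by (simp add: nn_integral_empty)
  also have "\<dots> \<le> ennreal (exp (s * \<phi> (\<lambda>_. undefined)))"
    using empty.prems(5)[of "\<lambda>_. undefined" "\<lambda>_. undefined"] by (simp add: space_PiM)
  also have "\<phi> (\<lambda>_. undefined) = (\<integral>x. \<phi> x \<partial>PiM {} M)"
    by (simp add: PiM_empty lebesgue_integral_count_space_finite)
  finally show ?case
    by simp
next
  case (insert i I)
  interpret product_prob_space M I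
    by (intro product_prob_space.intro product_sigma_finite.intro product_prob_space_axioms.intro
        prob prob_space_imp_sigma_finite)
  note [measurable] = insert.prems(2,3)
  interpret P': prob_space "PiM (insert i I) M"
    by (rule prob_space_PiM) (rule prob)
  define \<phi>' where "\<phi>' x = (\<integral>t. \<phi> (x(i := t)) \<partial>M i)" for x
  \<comment> \<open>The factor cancels what integrating out coordinate \<open>i\<close> costs by the
    one-dimensional lemma, so that \<open>\<phi>'\<close> and \<open>\<psi>'\<close> satisfy the
    hypothesis again, now on \<open>I\<close>.\<close>
  define \<psi>' where "\<psi>' x = ennreal (exp (- (s\<^sup>2 * (c i)\<^sup>2 / 8))) * (\<integral>\<^sup>+t. \<psi> (x(i := t)) \<partial>M i)" for x
  have upd: "x(i := t) \<in> space (PiM (insert i I) M)" if "x \<in> space (PiM I M)" "t \<in> space (M i)" for x t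
    using that by (auto simp: space_PiM PiE_def extensional_def)
  have sect[measurable]: "(\<lambda>t. \<phi> (x(i := t))) \<in> borel_measurable (M i)" if "x \<in> space (PiM I M)" for x
    using measurable_comp[OF measurable_component_update insert.prems(2), OF that insert.hyps(2)]
    unfolding comp_def .
  have int_sect: "integrable (M i) (\<lambda>t. \<phi> (x(i := t)))" if "x \<in> space (PiM I M)" for x
    using that by (intro M.integrable_const_bound[where B = K]) (auto intro: insert.prems upd)
  have "(\<integral>\<^sup>+x. \<psi>' x \<partial>PiM I M)
      \<le> ennreal (exp (s * (\<integral>x. \<phi>' x \<partial>PiM I M) + s\<^sup>2 * (\<Sum>i\<in>I. (c i)\<^sup>2) / 8))"
  proof (rule insert.IH)
    show "\<phi>' \<in> borel_measurable (PiM I M)"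
      unfolding \<phi>'_def by measurable
    show "\<psi>' \<in> borel_measurable (PiM I M)"
      unfolding \<psi>'_def by measurable
    show "\<bar>\<phi>' x\<bar> \<le> K" if x: "x \<in> space (PiM I M)" for x
    proof -
      have "\<phi> (x(i := t)) \<le> K" "- K \<le> \<phi> (x(i := t))" if "t \<in> space (M i)" for t
        using insert.prems(4)[OF upd[OF x that]] by (simp_all only: abs_le_iff minus_le_iff)
      then have "\<phi>' x \<le> K" "- K \<le> \<phi>' x"
        unfolding \<phi>'_def
        by - (rule M.integral_le_const M.integral_ge_const; use int_sect[OF x] in auto)+
      then show ?thesis
        by (simp only: abs_le_iff minus_le_iff)
    qed
    fix x y assume x: "x \<in> space (PiM I M)" and y: "y \<in> space (PiM I M)"
    define d where "d = sum c {j\<in>I. x j \<noteq> y j}"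
    have d0: "d \<ge> 0"
      unfolding d_def by (intro sum_nonneg) (auto intro: insert.prems)
    \<comment> \<open>A section of \<open>\<psi>\<close> at \<open>x\<close> is compared with one of
      \<open>\<phi>\<close> at \<open>y\<close>. Equal values of coordinate \<open>i\<close> give
      the pointwise bound of the one-dimensional lemma, different ones its oscillation bound with
      \<open>c i\<close>. The cost \<open>d\<close> of the other coordinates is constant and is
      added to \<open>\<phi>\<close>.\<close>
    have step: "\<psi> (x(i := t)) \<le> ennreal (exp (s * (\<phi> (y(i := u)) + d + (if t = u then 0 else c i))))"
      if "t \<in> space (M i)" "u \<in> space (M i)" for t u
    proof -
      have "{j \<in> insert i I. (x(i := t)) j \<noteq> (y(i := u)) j}
          = (if t = u then {j\<in>I. x j \<noteq> y j} else insert i {j\<in>I. x j \<noteq> y j})"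
        using insert.hyps by auto
      then have "sum c {j \<in> insert i I. (x(i := t)) j \<noteq> (y(i := u)) j} = d + (if t = u then 0 else c i)"
        using insert.hyps by (simp add: d_def)
      then show ?thesis
        using insert.prems(5)[OF upd[OF x that(1)] upd[OF y that(2)]] by (simp only: add.assoc)
    qed
    have "(\<integral>\<^sup>+t. \<psi> (x(i := t)) \<partial>M i)
        \<le> ennreal (exp (s * (\<integral>t. \<phi> (y(i := t)) + d \<partial>M i) + s\<^sup>2 * (c i)\<^sup>2 / 8))"
    proof (rule M.nn_integral_exp_le_of_oscillation)
      show "(\<lambda>t. \<phi> (y(i := t)) + d) \<in> borel_measurable (M i)"
        using y by measurable
      show "\<bar>\<phi> (y(i := t)) + d\<bar> \<le> K + d" if "t \<in> space (M i)" for t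
        using insert.prems(4)[OF upd[OF y that]] d0 by linarith
      show "\<psi> (x(i := t)) \<le> ennreal (exp (s * (\<phi> (y(i := t)) + d)))" if "t \<in> space (M i)" for t
        using step[OF that that] by simp
      show "\<psi> (x(i := t)) \<le> ennreal (exp (s * (\<phi> (y(i := u)) + d + c i)))"
        if "t \<in> space (M i)" "u \<in> space (M i)" for t u
        by (rule order_trans[OF step[OF that]]) (use s insert.prems(1)[of i] in \<open>auto intro!: ennreal_leI\<close>)
    qed (use s insert.prems(1) in auto)
    also have "(\<integral>t. \<phi> (y(i := t)) + d \<partial>M i) = \<phi>' y + d"
      using int_sect[OF y] by (simp add: \<phi>'_def M.prob_space)
    finally have "\<psi>' x \<le> ennreal (exp (- (s\<^sup>2 * (c i)\<^sup>2 / 8))) * ennreal (exp (s * (\<phi>' y + d) + s\<^sup>2 * (c i)\<^sup>2 / 8))"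
      unfolding \<psi>'_def by (rule mult_left_mono) simp
    then show "\<psi>' x \<le> ennreal (exp (s * (\<phi>' y + sum c {i\<in>I. x i \<noteq> y i})))"
      by (simp add: ennreal_mult[symmetric] exp_add[symmetric] d_def)
  qed (use insert.prems(1) in auto)
  moreover have "(\<integral>x. \<phi>' x \<partial>PiM I M) = (\<integral>x. \<phi> x \<partial>PiM (insert i I) M)"
    unfolding \<phi>'_def
    by (rule product_integral_insert[symmetric, OF insert.hyps(1,2) P'.integrable_const_bound[where B = K]])
      (auto intro: insert.prems)
  moreover have "(\<integral>\<^sup>+x. \<psi>' x \<partial>PiM I M)
      = ennreal (exp (- (s\<^sup>2 * (c i)\<^sup>2 / 8))) * (\<integral>\<^sup>+x. \<psi> x \<partial>PiM (insert i I) M)"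
    unfolding \<psi>'_def product_nn_integral_insert[OF insert.hyps(1,2) insert.prems(3)]
    by (rule nn_integral_cmult) measurable
  ultimately have le: "ennreal (exp (- (s\<^sup>2 * (c i)\<^sup>2 / 8))) * (\<integral>\<^sup>+x. \<psi> x \<partial>PiM (insert i I) M)
      \<le> ennreal (exp (s * (\<integral>x. \<phi> x \<partial>PiM (insert i I) M) + s\<^sup>2 * (\<Sum>i\<in>I. (c i)\<^sup>2) / 8))"
    by simp
  have "(\<integral>\<^sup>+x. \<psi> x \<partial>PiM (insert i I) M) = ennreal (exp (s\<^sup>2 * (c i)\<^sup>2 / 8)) *
      (ennreal (exp (- (s\<^sup>2 * (c i)\<^sup>2 / 8))) * (\<integral>\<^sup>+x. \<psi> x \<partial>PiM (insert i I) M))"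
    by (simp add: mult.assoc[symmetric] ennreal_mult[symmetric] exp_add[symmetric])
  also have "\<dots> \<le> ennreal (exp (s\<^sup>2 * (c i)\<^sup>2 / 8)) *
      ennreal (exp (s * (\<integral>x. \<phi> x \<partial>PiM (insert i I) M) + s\<^sup>2 * (\<Sum>i\<in>I. (c i)\<^sup>2) / 8))"
    by (intro mult_left_mono le) simp
  also have "\<dots> = ennreal (exp (s * (\<integral>x. \<phi> x \<partial>PiM (insert i I) M) + s\<^sup>2 * (\<Sum>i\<in>insert i I. (c i)\<^sup>2) / 8))"
    using insert.hyps by (simp add: ennreal_mult[symmetric] exp_add[symmetric] field_simps)
  finally show ?case .
qed

section \<open>Tail bounds for bounded differences on a subset\<close>

text \<open>Markov's inequality for \<open>exp (s * G x)\<close> restricted to \<open>A\<close>,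
  with \<open>s\<close> optimised at the end. The function \<open>\<phi>\<close> that replaces
  \<open>G\<close> need not have mean zero; the bound on its mean is what the exponent subtracts
  from \<open>\<epsilon>\<close>.\<close>

lemma prob_gt_le_of_bounded_differences_on:
  fixes I :: "'i set" and M :: "'i \<Rightarrow> 'a measure" and G :: "('i \<Rightarrow> 'a) \<Rightarrow> real"
  defines "N \<equiv> PiM I M"
  assumes prob: "\<And>i. prob_space (M i)" and "finite I" and c: "\<And>i. i \<in> I \<Longrightarrow> c i \<ge> 0"
    and c_pos: "(\<Sum>i\<in>I. (c i)\<^sup>2) > 0"
    and G[measurable]: "G \<in> borel_measurable N" and A[measurable]: "A \<in> sets N"
    and S: "\<And>x. x \<in> A \<Longrightarrow> \<bar>G x\<bar> \<le> S" and B: "AE x in N. \<bar>G x\<bar> \<le> B"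
    and mean: "(\<integral>x. G x \<partial>N) = 0"
    and diff: "\<And>x y. x \<in> A \<Longrightarrow> y \<in> A \<Longrightarrow> G x \<le> G y + sum c {i\<in>I. x i \<noteq> y i}"
    and \<epsilon>: "\<epsilon> \<ge> (1 - measure N A) * (B + S)"
    and S0: "S \<ge> 0"
  shows "measure N {x\<in>A. G x > \<epsilon>}
    \<le> exp (- (2 * (\<epsilon> - (1 - measure N A) * (B + S))\<^sup>2 / (\<Sum>i\<in>I. (c i)\<^sup>2)))"
proof -
  define \<sigma> where "\<sigma> = (\<Sum>i\<in>I. (c i)\<^sup>2)"
  define d where "d = \<epsilon> - (1 - measure N A) * (B + S)"
  interpret N: prob_space N
    unfolding N_def by (rule prob_space_PiM) (rule prob)
  have "measure N {x\<in>A. G x > \<epsilon>} \<le> exp (- (2 * d\<^sup>2 / \<sigma>))" if "d > 0"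
  proof -
    \<comment> \<open>minimises \<open>s\<^sup>2 \<sigma> / 8 - s d\<close>\<close>
    define s where "s = 4 * d / \<sigma>"
    have s: "s > 0"
      using that c_pos by (simp add: s_def \<sigma>_def)
    \<comment> \<open>Setting \<open>\<phi>\<close> to \<open>S\<close> and \<open>\<psi>\<close> to \<open>0\<close> off \<open>A\<close> makes the hypothesis there void.\<close>
    define \<phi> where "\<phi> x = (if x \<in> A then G x else S)" for x
    define \<psi> where "\<psi> x = ennreal (exp (s * G x)) * indicator A x" for x
    have [measurable]: "\<phi> \<in> borel_measurable N" "\<psi> \<in> borel_measurable N"
      unfolding \<phi>_def \<psi>_def by measurable
    have \<phi>_le: "\<bar>\<phi> x\<bar> \<le> S" for x
      using S S0 by (simp add: \<phi>_def)
    have "(\<integral>\<^sup>+x. \<psi> x \<partial>N) \<le> ennreal (exp (s * (\<integral>x. \<phi> x \<partial>N) + s\<^sup>2 * \<sigma> / 8))"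
      unfolding N_def \<sigma>_def
    proof (rule nn_integral_exp_le_of_bounded_differences)
      fix x y :: "'i \<Rightarrow> 'a"
      have "sum c {i\<in>I. x i \<noteq> y i} \<ge> 0"
        by (intro sum_nonneg) (auto intro: c)
      then show "\<psi> x \<le> ennreal (exp (s * (\<phi> y + sum c {i\<in>I. x i \<noteq> y i})))"
        using diff[of x y] S[of x] s
        by (auto simp: \<psi>_def \<phi>_def indicator_def abs_le_iff intro!: ennreal_leI)
    qed (use \<phi>_le s prob c \<open>finite I\<close> in \<open>auto simp: N_def[symmetric]\<close>)
    also have "(\<integral>x. \<phi> x \<partial>N) \<le> (1 - measure N A) * (B + S)"
    proof -
      have iG: "integrable N G"
        using B by (intro N.integrable_const_bound[where B = B]) auto
      have i\<phi>: "integrable N \<phi>"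
        using \<phi>_le by (intro N.integrable_const_bound[where B = S]) auto
      \<comment> \<open>As \<open>G\<close> has mean zero, subtracting it changes nothing; the
        difference vanishes on \<open>A\<close> and is at most \<open>B + S\<close> off it.\<close>
      have "(\<integral>x. \<phi> x \<partial>N) = (\<integral>x. \<phi> x - G x \<partial>N)"
        using iG i\<phi> mean by simp
      also have "\<dots> \<le> (\<integral>x. indicator (space N - A) x * (B + S) \<partial>N)"
      proof (rule integral_mono_AE)
        show "integrable N (\<lambda>x. \<phi> x - G x)"
          using iG i\<phi> by simp
        show "integrable N (\<lambda>x. indicator (space N - A) x * (B + S))"
          by (intro integrable_mult_left integrable_real_indicator)
            (auto simp: N.emeasure_eq_measure)
        show "AE x in N. \<phi> x - G x \<le> indicator (space N - A) x * (B + S)"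
          using B by (auto simp: \<phi>_def indicator_def)
      qed
      also have "\<dots> = (1 - measure N A) * (B + S)"
        by (simp add: N.prob_compl A)
      finally show ?thesis .
    qed
    finally have le: "(\<integral>\<^sup>+x. \<psi> x \<partial>N) \<le> ennreal (exp (s * ((1 - measure N A) * (B + S)) + s\<^sup>2 * \<sigma> / 8))"
      using s by (simp add: mult_left_mono)
    have [measurable]: "{x\<in>A. G x > \<epsilon>} \<in> sets N"
      by measurable
    have "emeasure N {x\<in>A. G x > \<epsilon>} = (\<integral>\<^sup>+x. indicator {x\<in>A. G x > \<epsilon>} x \<partial>N)"
      by simp
    also have "\<dots> \<le> (\<integral>\<^sup>+x. ennreal (exp (- (s * \<epsilon>))) * \<psi> x \<partial>N)"
      using s by (intro nn_integral_mono)
        (auto simp: indicator_def \<psi>_def ennreal_mult[symmetric] exp_add[symmetric])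
    also have "\<dots> = ennreal (exp (- (s * \<epsilon>))) * (\<integral>\<^sup>+x. \<psi> x \<partial>N)"
      by (rule nn_integral_cmult) measurable
    also have "\<dots> \<le> ennreal (exp (- (s * \<epsilon>))) * ennreal (exp (s * ((1 - measure N A) * (B + S)) + s\<^sup>2 * \<sigma> / 8))"
      by (intro mult_left_mono le) simp
    also have "\<dots> = ennreal (exp (- (s * d) + s\<^sup>2 * \<sigma> / 8))"
      by (simp add: ennreal_mult[symmetric] exp_add[symmetric] d_def algebra_simps)
    also have "- (s * d) + s\<^sup>2 * \<sigma> / 8 = - (2 * d\<^sup>2 / \<sigma>)"
      using c_pos by (simp add: s_def \<sigma>_def[symmetric] field_simps power2_eq_square)
    finally show ?thesis
      by (simp add: N.emeasure_eq_measure)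
  qed
  \<comment> \<open>For \<open>d = 0\<close> the choice of \<open>s\<close> degenerates to
    \<open>0\<close>, but the claimed bound is then \<open>1\<close>.\<close>
  moreover have "measure N {x\<in>A. G x > \<epsilon>} \<le> exp (- (2 * d\<^sup>2 / \<sigma>))" if "d = 0"
    using that by simp
  ultimately show ?thesis
    using \<epsilon> unfolding d_def \<sigma>_def by argo
qed

text \<open>The hypotheses are symmetric in \<open>G\<close> and \<open>- G\<close>, so the
  one-sided bound holds for both. The complement of \<open>A\<close> enters with its whole
  measure.\<close>

lemma prob_abs_gt_le_of_bounded_differences_on:
  fixes I :: "'i set" and M :: "'i \<Rightarrow> 'a measure" and G :: "('i \<Rightarrow> 'a) \<Rightarrow> real"
  defines "N \<equiv> PiM I M"
  assumes prob: "\<And>i. prob_space (M i)" and "finite I" and c: "\<And>i. i \<in> I \<Longrightarrow> c i \<ge> 0"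
    and c_pos: "(\<Sum>i\<in>I. (c i)\<^sup>2) > 0"
    and G[measurable]: "G \<in> borel_measurable N" and A[measurable]: "A \<in> sets N"
    and S: "\<And>x. x \<in> A \<Longrightarrow> \<bar>G x\<bar> \<le> S" and B: "AE x in N. \<bar>G x\<bar> \<le> B"
    and mean: "(\<integral>x. G x \<partial>N) = 0"
    and diff: "\<And>x y. x \<in> A \<Longrightarrow> y \<in> A \<Longrightarrow> \<bar>G x - G y\<bar> \<le> sum c {i\<in>I. x i \<noteq> y i}"
    and \<epsilon>: "\<epsilon> \<ge> (1 - measure N A) * (B + S)"
    and S0: "S \<ge> 0"
  shows "measure N {x\<in>space N. \<bar>G x\<bar> > \<epsilon>} \<le> (1 - measure N A) +
     2 * exp (- (2 * (\<epsilon> - (1 - measure N A) * (B + S))\<^sup>2 / (\<Sum>i\<in>I. (c i)\<^sup>2)))" (is "_ \<le> _ + 2 * ?E")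
proof -
  interpret N: prob_space N
    unfolding N_def by (rule prob_space_PiM) (rule prob)
  have 1: "measure N {x\<in>A. G x > \<epsilon>} \<le> ?E"
    unfolding N_def
  proof (rule prob_gt_le_of_bounded_differences_on)
    show "G x \<le> G y + sum c {i\<in>I. x i \<noteq> y i}" if "x \<in> A" "y \<in> A" for x y
      using diff[OF that] by (simp add: abs_le_iff)
  qed (use assms(2-)[unfolded N_def] in simp_all)
  have 2: "measure N {x\<in>A. - G x > \<epsilon>} \<le> ?E"
    unfolding N_def
  proof (rule prob_gt_le_of_bounded_differences_on)
    show "- G x \<le> - G y + sum c {i\<in>I. x i \<noteq> y i}" if "x \<in> A" "y \<in> A" for x y
      using diff[OF that] by (simp add: abs_le_iff)
  qed (use assms(2-)[unfolded N_def] in simp_all)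
  have "measure N {x\<in>space N. \<bar>G x\<bar> > \<epsilon>}
      \<le> measure N ((space N - A) \<union> ({x\<in>A. G x > \<epsilon>} \<union> {x\<in>A. - G x > \<epsilon>}))"
    by (intro N.finite_measure_mono) (auto simp: abs_if split: if_splits)
  also have "\<dots> \<le> measure N (space N - A) + measure N ({x\<in>A. G x > \<epsilon>} \<union> {x\<in>A. - G x > \<epsilon>})"
    by (intro measure_Un_le) measurable
  also have "\<dots> \<le> measure N (space N - A) + (measure N {x\<in>A. G x > \<epsilon>} + measure N {x\<in>A. - G x > \<epsilon>})"
    by (intro add_left_mono measure_Un_le) measurable
  also have "measure N (space N - A) = 1 - measure N A"
    by (rule N.prob_compl) fact
  finally show ?thesis
    using 1 2 by linarith
qed

section \<open>Deletion of a node and pointwise estimates\<close>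

text \<open>The coface map: the increasing injection of the naturals whose range misses exactly
  \<open>i\<close>.\<close>

definition skip :: "nat \<Rightarrow> nat \<Rightarrow> nat" where
  "skip i j = (if j < i then j else Suc j)"

text \<open>The right side is the index list of \<open>leave_out\<close>; deleting an entry thus
  becomes reindexing along \<open>skip i\<close>, to which the invariance of product measures
  applies.\<close>

lemma map_skip_upt:
  assumes "i \<in> {1..n}"
  shows "map (skip i) [1..<n] = [1..<i] @ [Suc i..<Suc n]"
proof -
  have "[1..<n] = [1..<i] @ [i..<n]"
    using assms upt_add_eq_append[of 1 i "n - i"] by simp
  moreover have "map (skip i) [1..<i] = [1..<i]"
    by (rule map_idI) (simp add: skip_def)
  moreover have "map (skip i) [i..<n] = map Suc [i..<n]"
    by (rule map_cong) (simp_all add: skip_def)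
  ultimately show ?thesis
    by (simp only: map_append map_Suc_upt)
qed

lemma inj_skip: "inj (skip i)"
  by (auto simp: inj_def skip_def split: if_splits)

text \<open>Factor the difference of squares and use the reverse triangle inequality. With
  \<open>C1\<close> for \<open>C\<close> this is the source of the factor \<open>2 * C1\<close> in
  the difference bounds.\<close>

lemma abs_cmod_power2_diff_le:
  assumes "cmod a \<le> C" "cmod b \<le> C"
  shows "\<bar>(cmod a)\<^sup>2 - (cmod b)\<^sup>2\<bar> \<le> 2 * C * cmod (a - b)"
proof -
  have "\<bar>(cmod a)\<^sup>2 - (cmod b)\<^sup>2\<bar> = (cmod a + cmod b) * \<bar>cmod a - cmod b\<bar>"
    by (simp add: power2_eq_square square_diff_square_factored abs_mult)
  also have "\<dots> \<le> (2 * C) * cmod (a - b)"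
    using assms norm_triangle_ineq3[of a b] order_trans[OF norm_ge_zero assms(1)]
    by (intro mult_mono) auto
  finally show ?thesis .
qed

lemma cmod_less_of_sup_norm_less:
  assumes "sup_norm \<Omega> g < ennreal C" "x \<in> \<Omega>"
  shows "cmod (g x) < C"
proof -
  have "ennreal (cmod (g x)) \<le> sup_norm \<Omega> g"
    unfolding sup_norm_def using assms(2) by (rule SUP_upper)
  then have "ennreal (cmod (g x)) < ennreal C"
    using assms(1) by (rule le_less_trans)
  then show ?thesis
    by (simp add: ennreal_less_iff)
qed

section \<open>Score and risk as functions of the nodes\<close>

text \<open>A reconstruction uses \<open>n - 1\<close> nodes, here indexed by
  \<open>{1..<n}\<close>. Measurability is joint in nodes and evaluation point, so that the risk is
  measurable in the nodes and Fubini applies.\<close>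

locale cross_validation = prob_space \<rho> for \<rho> :: "'a measure" +
  fixes f :: "'a \<Rightarrow> complex" and R :: "('h, 'a) reconstruction" and h :: 'h and n :: nat
  assumes n_pos: "n \<ge> 1"
    and f_measurable[measurable]: "f \<in> borel_measurable \<rho>"
    and R_measurable: "(\<lambda>(x, t). R h (map (\<lambda>i. (x i, f (x i))) [1..<n]) t)
          \<in> borel_measurable ((\<Pi>\<^sub>M i\<in>{1..<n}. \<rho>) \<Otimes>\<^sub>M \<rho>)"
begin

abbreviation N :: "(nat \<Rightarrow> 'a) measure" where "N \<equiv> \<Pi>\<^sub>M i\<in>{1..n}. \<rho>"

definition del :: "nat \<Rightarrow> (nat \<Rightarrow> 'a) \<Rightarrow> nat \<Rightarrow> 'a" where
  "del i x = (\<lambda>j\<in>{1..<n}. x (skip i j))"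

text \<open>Nodes and evaluation point are separate arguments: the score averages values of this
  function, and the risk integrates it over the second argument.\<close>

definition sq_err :: "(nat \<Rightarrow> 'a) \<Rightarrow> 'a \<Rightarrow> real" where
  "sq_err y t = (cmod (R h (map (\<lambda>j. (y j, f (y j))) [1..<n]) t - f t))\<^sup>2"

text \<open>The function \<open>G\<close> of the overview, signed so that its mean can
  vanish.\<close>

definition deviation :: "(nat \<Rightarrow> 'a) \<Rightarrow> real" where
  "deviation x = cv_score f R n (graph_sample f n x) h - risk \<rho> f (R h (leave_out n (graph_sample f n x) 1))"

lemma leave_out_graph_sample:
  assumes i: "i \<in> {1..n}"
  shows "leave_out n (graph_sample f n x) i = map (\<lambda>j. (del i x j, f (del i x j))) [1..<n]"
  unfolding leave_out_def map_skip_upt[OF i, symmetric] map_map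
  by (rule map_cong) (use i in \<open>auto simp: graph_sample_def del_def skip_def\<close>)

lemma deviation_eq:
  "deviation x = 1 / real n * (\<Sum>i=1..n. sq_err (del i x) (x i)) - (\<integral>t. sq_err (del 1 x) t \<partial>\<rho>)"
proof -
  have "(cmod (R h (leave_out n (graph_sample f n x) i) (fst (graph_sample f n x i)) - f (fst (graph_sample f n x i))))\<^sup>2
      = sq_err (del i x) (x i)" if "i \<in> {1..n}" for i
    using that by (simp only: leave_out_graph_sample sq_err_def) (simp add: graph_sample_def)
  then have "cv_score f R n (graph_sample f n x) h = 1 / real n * (\<Sum>i=1..n. sq_err (del i x) (x i))"
    unfolding cv_score_def by (simp cong: sum.cong_simp)
  moreover have "risk \<rho> f (R h (leave_out n (graph_sample f n x) 1)) = (\<integral>t. sq_err (del 1 x) t \<partial>\<rho>)"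
    using n_pos leave_out_graph_sample[of 1] by (simp add: risk_def sq_err_def)
  ultimately show ?thesis
    unfolding deviation_def by simp
qed

sublocale N: prob_space N
  by (rule prob_space_PiM) (rule prob_space_axioms)

lemma del_measurable[measurable]: "i \<in> {1..n} \<Longrightarrow> del i \<in> N \<rightarrow>\<^sub>M (\<Pi>\<^sub>M j\<in>{1..<n}. \<rho>)"
  unfolding del_def
  by (intro measurable_restrict measurable_component_singleton) (auto simp: skip_def)

lemma sq_err_measurable[measurable]: "(\<lambda>(y, t). sq_err y t) \<in> borel_measurable ((\<Pi>\<^sub>M j\<in>{1..<n}. \<rho>) \<Otimes>\<^sub>M \<rho>)"
proof -
  have "(\<lambda>p. (cmod ((\<lambda>(x, t). R h (map (\<lambda>i. (x i, f (x i))) [1..<n]) t) p - f (snd p)))\<^sup>2)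
      \<in> borel_measurable ((\<Pi>\<^sub>M j\<in>{1..<n}. \<rho>) \<Otimes>\<^sub>M \<rho>)"
    using R_measurable by measurable
  then show ?thesis
    by (simp add: sq_err_def case_prod_unfold)
qed

lemma sq_err_at_measurable[measurable]:
  assumes [measurable]: "i \<in> {1..n}"
  shows "(\<lambda>x. sq_err (del i x) (x i)) \<in> borel_measurable N"
proof -
  have "(\<lambda>x. (del i x, x i)) \<in> N \<rightarrow>\<^sub>M (\<Pi>\<^sub>M j\<in>{1..<n}. \<rho>) \<Otimes>\<^sub>M \<rho>"
    using assms by measurable
  from measurable_compose[OF this sq_err_measurable] show ?thesis
    by simp
qed

lemma risk_measurable[measurable]:
  "(\<lambda>y. \<integral>t. sq_err y t \<partial>\<rho>) \<in> borel_measurable (\<Pi>\<^sub>M j\<in>{1..<n}. \<rho>)"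
  by (rule borel_measurable_lebesgue_integral) (rule sq_err_measurable)

lemma deviation_measurable[measurable]: "deviation \<in> borel_measurable N"
proof -
  have [measurable]: "(\<lambda>x. \<integral>t. sq_err (del 1 x) t \<partial>\<rho>) \<in> borel_measurable N"
    using measurable_compose[OF del_measurable risk_measurable, of 1] n_pos by simp
  have [measurable]: "(\<lambda>x. \<Sum>i=1..n. sq_err (del i x) (x i)) \<in> borel_measurable N"
    by (intro borel_measurable_sum sq_err_at_measurable)
  show ?thesis
    unfolding deviation_eq[abs_def] by measurable
qed

lemma del_space: "x \<in> space N \<Longrightarrow> i \<in> {1..n} \<Longrightarrow> del i x \<in> space (\<Pi>\<^sub>M j\<in>{1..<n}. \<rho>)"
  using measurable_space[OF del_measurable] by blast

lemma sq_err_nonneg: "sq_err y t \<ge> 0"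
  by (simp add: sq_err_def)

lemma sq_err_section_measurable[measurable]:
  "y \<in> space (\<Pi>\<^sub>M j\<in>{1..<n}. \<rho>) \<Longrightarrow> sq_err y \<in> borel_measurable \<rho>"
  using measurable_compose[OF measurable_Pair1' sq_err_measurable] by (simp cong: measurable_cong)

section \<open>The mean of the deviation\<close>

text \<open>By exchangeability every term of the score has the mean of the term for the last node.
  In that term the evaluation point is independent of the nodes used for the reconstruction, so
  integrating it out first leaves the mean risk.\<close>

lemma integral_sq_err_at:
  assumes i: "i \<in> {1..n}" and B: "AE x in N. sq_err (del n x) (x n) \<le> B"
  shows "integrable N (\<lambda>x. sq_err (del i x) (x i))"
    and "(\<integral>x. sq_err (del i x) (x i) \<partial>N) = (\<integral>x. (\<integral>t. sq_err (del 1 x) t \<partial>\<rho>) \<partial>N)"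
proof -
  note prob_\<rho> = prob_space_axioms
  define g where "g x = sq_err (del n x) (x n)" for x
  have g_meas[measurable]: "g \<in> borel_measurable N"
    unfolding g_def using n_pos by (intro sq_err_at_measurable) auto
  have g_int: "integrable N g"
    by (rule N.integrable_const_bound[OF _ g_meas, where B = B])
      (use B in \<open>simp add: g_def sq_err_nonneg\<close>)
  \<comment> \<open>The permutation moving the \<open>i\<close>-th node to the end; it preserves the product measure.\<close>
  define \<tau> where "\<tau> j = (if j = n then i else skip i j)" for j
  define T where "T x = (\<lambda>j\<in>{1..n}. x (\<tau> j))" for x :: "nat \<Rightarrow> 'a"
  have \<tau>: "inj_on \<tau> {1..n}" "\<tau> \<in> {1..n} \<rightarrow> {1..n}"
    using i by (auto simp: \<tau>_def inj_on_def skip_def split: if_splits)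
  have T_distr: "distr N N T = N"
    unfolding T_def[abs_def]
    by (rule distr_PiM_reindex[where M = "\<lambda>_. \<rho>", OF _ \<tau>]) (rule prob_space_axioms)
  have T_meas[measurable]: "T \<in> N \<rightarrow>\<^sub>M N"
    unfolding T_def using \<tau> by (intro measurable_restrict measurable_component_singleton) auto
  have gT: "g (T x) = sq_err (del i x) (x i)" for x
  proof -
    have "del n (T x) = del i x"
      using i by (auto simp: del_def T_def \<tau>_def skip_def fun_eq_iff)
    moreover have "T x n = x i"
      using n_pos by (simp add: T_def \<tau>_def)
    ultimately show ?thesis
      by (simp add: g_def)
  qed
  show "integrable N (\<lambda>x. sq_err (del i x) (x i))"
    using g_int integrable_distr[OF T_meas, of g] unfolding T_distr gT by simp
  interpret product_prob_space "\<lambda>_. \<rho>" "{1..<n}"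
    by (intro product_prob_space.intro product_sigma_finite.intro product_prob_space_axioms.intro
        prob_space_imp_sigma_finite) (rule prob_space_axioms)+
  have ins: "insert n {1..<n} = {1..n}"
    using n_pos by auto
  have "(\<integral>x. sq_err (del i x) (x i) \<partial>N) = (\<integral>x. g x \<partial>distr N N T)"
    by (simp only: integral_distr[OF T_meas g_meas] gT)
  also have "\<dots> = (\<integral>x. g x \<partial>N)"
    by (simp only: T_distr)
  also have "\<dots> = (\<integral>x. (\<integral>t. g (x(n := t)) \<partial>\<rho>) \<partial>(\<Pi>\<^sub>M j\<in>{1..<n}. \<rho>))"
    using product_integral_insert[of "{1..<n}" n g] g_int unfolding ins by simp
  also have "\<dots> = (\<integral>y. (\<integral>t. sq_err y t \<partial>\<rho>) \<partial>(\<Pi>\<^sub>M j\<in>{1..<n}. \<rho>))"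
  proof (intro Bochner_Integration.integral_cong refl)
    fix y t assume "y \<in> space (\<Pi>\<^sub>M j\<in>{1..<n}. \<rho>)"
    then have "del n (y(n := t)) = y"
      by (auto simp: del_def skip_def space_PiM PiE_def extensional_def fun_eq_iff)
    then show "g (y(n := t)) = sq_err y t"
      by (simp add: g_def)
  qed
  \<comment> \<open>Fubini leaves the first \<open>n - 1\<close> nodes, whereas the risk is taken
    without node \<open>1\<close>; both families have the same law, since \<open>skip 1\<close> is
    an injective reindexing.\<close>
  also have "\<dots> = (\<integral>y. (\<integral>t. sq_err y t \<partial>\<rho>) \<partial>distr N (\<Pi>\<^sub>M j\<in>{1..<n}. \<rho>) (del 1))"
  proof -
    have "distr N (\<Pi>\<^sub>M j\<in>{1..<n}. \<rho>) (del 1) = (\<Pi>\<^sub>M j\<in>{1..<n}. \<rho>)"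
      unfolding del_def[abs_def]
    proof (rule distr_PiM_reindex[where M = "\<lambda>_. \<rho>"])
      show "inj_on (skip 1) {1..<n}"
        by (rule inj_on_subset[OF inj_skip]) simp
      show "skip 1 \<in> {1..<n} \<rightarrow> {1..n}"
        by (auto simp: skip_def)
    qed (rule prob_\<rho>)
    then show ?thesis
      by simp
  qed
  also have "\<dots> = (\<integral>x. (\<integral>t. sq_err (del 1 x) t \<partial>\<rho>) \<partial>N)"
    using n_pos by (intro integral_distr) measurable
  finally show "(\<integral>x. sq_err (del i x) (x i) \<partial>N) = (\<integral>x. (\<integral>t. sq_err (del 1 x) t \<partial>\<rho>) \<partial>N)" .
qed

lemma integral_sq_err_mem:
  assumes "y \<in> space (\<Pi>\<^sub>M j\<in>{1..<n}. \<rho>)" "\<And>t. t \<in> space \<rho> \<Longrightarrow> sq_err y t \<le> B"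
  shows "(\<integral>t. sq_err y t \<partial>\<rho>) \<in> {0..B}" "integrable \<rho> (sq_err y)"
proof -
  show int: "integrable \<rho> (sq_err y)"
    using assms by (intro integrable_const_bound[where B = B]) (auto simp: sq_err_nonneg)
  show "(\<integral>t. sq_err y t \<partial>\<rho>) \<in> {0..B}"
    using assms(2) by (auto simp: sq_err_nonneg intro!: integral_le_const int)
qed

text \<open>Score and risk both lie in \<open>{0..B}\<close>, so their difference is at most
  \<open>B\<close>, without a factor 2.\<close>

lemma abs_deviation_le:
  assumes x: "x \<in> space N" and B: "\<And>i t. i \<in> {1..n} \<Longrightarrow> t \<in> space \<rho> \<Longrightarrow> sq_err (del i x) t \<le> B"
  shows "\<bar>deviation x\<bar> \<le> B"
proof -
  have "x i \<in> space \<rho>" if "i \<in> {1..n}" for i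
    using x that by (auto simp: space_PiM)
  then have "(\<Sum>i=1..n. sq_err (del i x) (x i)) \<le> (\<Sum>i=1..n. B)"
    by (intro sum_mono B)
  then have "1 / real n * (\<Sum>i=1..n. sq_err (del i x) (x i)) \<le> B"
    using n_pos by (simp add: field_simps)
  moreover have "1 / real n * (\<Sum>i=1..n. sq_err (del i x) (x i)) \<ge> 0"
    by (intro mult_nonneg_nonneg sum_nonneg sq_err_nonneg) simp
  moreover have "(\<integral>t. sq_err (del 1 x) t \<partial>\<rho>) \<in> {0..B}"
    using n_pos by (intro integral_sq_err_mem del_space x B) auto
  ultimately show ?thesis
    unfolding deviation_eq by auto
qed

text \<open>The bound is required almost surely only, so that \<open>C1\<^sup>2\<close> can serve as
  \<open>B\<close> when \<gamma> is zero.\<close>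

lemma integral_deviation:
  assumes B: "AE x in N. \<forall>i\<in>{1..n}. \<forall>t\<in>space \<rho>. sq_err (del i x) t \<le> B"
  shows "(\<integral>x. deviation x \<partial>N) = 0"
proof -
  define e where "e = (\<integral>x. (\<integral>t. sq_err (del 1 x) t \<partial>\<rho>) \<partial>N)"
  have Bn: "AE x in N. sq_err (del n x) (x n) \<le> B"
    using B AE_space
  proof eventually_elim
    case (elim x)
    have "x n \<in> space \<rho>"
      using elim(2) n_pos by (auto simp: space_PiM dest: PiE_mem)
    then show ?case
      using elim(1) n_pos by auto
  qed
  have "AE x in N. norm (\<integral>t. sq_err (del 1 x) t \<partial>\<rho>) \<le> B"
    using B AE_space
  proof eventually_elim
    case (elim x)
    have "(\<integral>t. sq_err (del 1 x) t \<partial>\<rho>) \<in> {0..B}"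
      using n_pos elim by (intro integral_sq_err_mem del_space) auto
    then show ?case
      by simp
  qed
  then have int_risk: "integrable N (\<lambda>x. \<integral>t. sq_err (del 1 x) t \<partial>\<rho>)"
    using measurable_compose[OF del_measurable risk_measurable, of 1] n_pos
    by (intro N.integrable_const_bound[where B = B]) auto
  note int_term = integral_sq_err_at(1)[OF _ Bn]
  have int_cv: "integrable N (\<lambda>x. 1 / real n * (\<Sum>i=1..n. sq_err (del i x) (x i)))"
    by (intro integrable_mult_right Bochner_Integration.integrable_sum int_term)
  have "(\<integral>x. deviation x \<partial>N) = (\<integral>x. 1 / real n * (\<Sum>i=1..n. sq_err (del i x) (x i)) \<partial>N) - e"
    unfolding deviation_eq e_def using int_cv int_risk by (rule Bochner_Integration.integral_diff)
  also have "(\<integral>x. 1 / real n * (\<Sum>i=1..n. sq_err (del i x) (x i)) \<partial>N)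
      = 1 / real n * (\<Sum>i=1..n. \<integral>x. sq_err (del i x) (x i) \<partial>N)"
    by (simp only: integral_mult_right_zero Bochner_Integration.integral_sum[OF int_term])
  also have "(\<Sum>i=1..n. \<integral>x. sq_err (del i x) (x i) \<partial>N) = (\<Sum>i=1..n. e)"
    unfolding e_def by (intro sum.cong refl integral_sq_err_at(2)[OF _ Bn])
  finally show ?thesis
    using n_pos by simp
qed


section \<open>Bounded differences on admissible samples\<close>

definition good :: "(nat \<Rightarrow> 'a \<times> complex) set \<Rightarrow> (nat \<Rightarrow> 'a) set" where
  "good \<Xi> = {x \<in> space N. graph_sample f n x \<in> \<Xi>}"

lemma sq_err_eq:
  "i \<in> {1..n} \<Longrightarrow> sq_err (del i x) t = (cmod (R h (leave_out n (graph_sample f n x) i) t - f t))\<^sup>2"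
  by (simp add: leave_out_graph_sample sq_err_def)

context
  fixes Y :: "complex set" and C1 C2 :: real and \<Xi> :: "(nat \<Rightarrow> 'a \<times> complex) set"
  assumes C1: "C1 > 0" and C2: "C2 > 0" and adm: "admissible (space \<rho>) Y f R n h C1 C2 \<Xi>"
begin

lemma good_residual_less:
  assumes "x \<in> good \<Xi>" "i \<in> {1..n}" "t \<in> space \<rho>"
  shows "cmod (R h (leave_out n (graph_sample f n x) i) t - f t) < C1"
proof -
  have "sup_norm (space \<rho>) (\<lambda>t. R h (leave_out n (graph_sample f n x) i) t - f t) < ennreal C1"
    using adm assms(1,2) by (auto simp: admissible_def good_def)
  then show ?thesis
    using assms(3) by (rule cmod_less_of_sup_norm_less)
qed

lemma sq_err_good:
  assumes "x \<in> good \<Xi>" "i \<in> {1..n}" "t \<in> space \<rho>"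
  shows "sq_err (del i x) t \<le> C1\<^sup>2"
  using good_residual_less[OF assms] assms(2) by (simp add: sq_err_eq power_mono)

text \<open>The evaluation point is fixed: (ii) controls the change of the reconstruction, and the
  residual bound (i) turns this into control of the squares.\<close>

lemma sq_err_good_diff:
  assumes x: "x \<in> good \<Xi>" and y: "y \<in> good \<Xi>" and i: "i \<in> {1..n}" and t: "t \<in> space \<rho>"
  shows "\<bar>sq_err (del i x) t - sq_err (del i y) t\<bar> \<le> 2 * C1 * C2 * real (card {j\<in>{1..n}. x j \<noteq> y j})"
proof -
  let ?zx = "graph_sample f n x" and ?zy = "graph_sample f n y"
  have "cmod (R h (leave_out n ?zx i) t - R h (leave_out n ?zy i) t)
      \<le> C2 * real (card {j \<in> {1..n} - {i}. ?zx j \<noteq> ?zy j})"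
    using adm x y i t unfolding admissible_def good_def by blast
  also have "\<dots> \<le> C2 * real (card {j\<in>{1..n}. x j \<noteq> y j})"
    using C2 by (intro mult_left_mono of_nat_mono card_mono) (auto simp: graph_sample_def)
  finally have "2 * C1 * cmod (R h (leave_out n ?zx i) t - R h (leave_out n ?zy i) t)
      \<le> 2 * C1 * (C2 * real (card {j\<in>{1..n}. x j \<noteq> y j}))"
    using C1 by (intro mult_left_mono) auto
  moreover have "\<bar>sq_err (del i x) t - sq_err (del i y) t\<bar>
      \<le> 2 * C1 * cmod (R h (leave_out n ?zx i) t - R h (leave_out n ?zy i) t)"
    using abs_cmod_power2_diff_le[OF less_imp_le[OF good_residual_less[OF x i t]]
        less_imp_le[OF good_residual_less[OF y i t]]] i by (simp add: sq_err_eq)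
  ultimately show ?thesis
    by (simp add: mult.assoc)
qed

text \<open>Through the reconstruction, each changed node moves every term of the score, and also
  the risk, by at most \<open>2 * C1 * C2\<close>; this gives \<open>4 * C1 * C2\<close>. As an
  evaluation point it moves one term by at most \<open>C1\<^sup>2\<close>, which averaging divides
  by \<open>n\<close>.\<close>

lemma deviation_good_diff:
  assumes x: "x \<in> good \<Xi>" and y: "y \<in> good \<Xi>"
  shows "\<bar>deviation x - deviation y\<bar> \<le> (C1\<^sup>2 / real n + 4 * C1 * C2) * real (card {j\<in>{1..n}. x j \<noteq> y j})"
proof -
  define D where "D = {j\<in>{1..n}. x j \<noteq> y j}"
  define d where "d = real (card D)"
  have xs: "x \<in> space N" and ys: "y \<in> space N"
    using x y by (auto simp: good_def)
  then have comp: "x i \<in> space \<rho>" "y i \<in> space \<rho>" if "i \<in> {1..n}" for i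
    using that by (auto simp: space_PiM)
  \<comment> \<open>If the evaluation point changes, both values lie between \<open>0\<close> and
    \<open>C1\<^sup>2\<close>, which alone bounds the difference. If not, only the reconstruction
    changes.\<close>
  have term_le: "\<bar>sq_err (del i x) (x i) - sq_err (del i y) (y i)\<bar> \<le> 2 * C1 * C2 * d + C1\<^sup>2 * indicator D i"
    if i: "i \<in> {1..n}" for i
  proof (cases "i \<in> D")
    case True
    have "\<bar>sq_err (del i x) (x i) - sq_err (del i y) (y i)\<bar> \<le> C1\<^sup>2"
      using sq_err_good[OF x i comp(1)[OF i]] sq_err_good[OF y i comp(2)[OF i]]
        sq_err_nonneg[of "del i x" "x i"] sq_err_nonneg[of "del i y" "y i"] by linarith
    moreover have "2 * C1 * C2 * d \<ge> 0"
      using C1 C2 by (simp add: d_def)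
    ultimately show ?thesis
      using True by simp
  next
    case False
    then have "x i = y i"
      using i by (simp add: D_def)
    then show ?thesis
      using sq_err_good_diff[OF x y i comp(1)[OF i]] False by (simp add: d_def D_def)
  qed
  have "\<bar>(\<Sum>i=1..n. sq_err (del i x) (x i)) - (\<Sum>i=1..n. sq_err (del i y) (y i))\<bar>
      \<le> (\<Sum>i=1..n. \<bar>sq_err (del i x) (x i) - sq_err (del i y) (y i)\<bar>)"
    unfolding sum_subtractf[symmetric] by (rule sum_abs)
  also have "\<dots> \<le> (\<Sum>i=1..n. 2 * C1 * C2 * d + C1\<^sup>2 * indicator D i)"
    by (intro sum_mono term_le)
  also have "\<dots> = real n * (2 * C1 * C2 * d) + C1\<^sup>2 * d"
  proof -
    have "(\<Sum>i=1..n. indicator D i) = d"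
      by (subst sum.mono_neutral_cong_right[of "{1..n}" D _ "\<lambda>_. 1"]) (auto simp: D_def d_def)
    then show ?thesis
      by (simp add: sum.distrib sum_distrib_left[symmetric])
  qed
  finally have "1 / real n * \<bar>(\<Sum>i=1..n. sq_err (del i x) (x i)) - (\<Sum>i=1..n. sq_err (del i y) (y i))\<bar>
      \<le> 1 / real n * (real n * (2 * C1 * C2 * d) + C1\<^sup>2 * d)"
    by (intro mult_left_mono) auto
  then have cv: "\<bar>1 / real n * (\<Sum>i=1..n. sq_err (del i x) (x i)) - 1 / real n * (\<Sum>i=1..n. sq_err (del i y) (y i))\<bar>
      \<le> 2 * C1 * C2 * d + C1\<^sup>2 / real n * d"
    using n_pos by (simp add: right_diff_distrib[symmetric] abs_mult field_simps)
  have 1: "1 \<in> {1..n}"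
    using n_pos by simp
  have int: "integrable \<rho> (sq_err (del 1 x))" "integrable \<rho> (sq_err (del 1 y))"
    using integral_sq_err_mem(2) del_space[OF xs 1] del_space[OF ys 1] sq_err_good[OF x 1] sq_err_good[OF y 1]
    by blast+
  have "\<bar>(\<integral>t. sq_err (del 1 x) t \<partial>\<rho>) - (\<integral>t. sq_err (del 1 y) t \<partial>\<rho>)\<bar>
      = \<bar>\<integral>t. sq_err (del 1 x) t - sq_err (del 1 y) t \<partial>\<rho>\<bar>"
    using int by simp
  also have "\<dots> \<le> (\<integral>t. \<bar>sq_err (del 1 x) t - sq_err (del 1 y) t\<bar> \<partial>\<rho>)"
    by (rule integral_abs_bound)
  also have "\<dots> \<le> 2 * C1 * C2 * d"
    using int sq_err_good_diff[OF x y 1] by (intro integral_le_const AE_I2) (auto simp: d_def D_def)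
  finally show ?thesis
    using cv unfolding deviation_eq d_def[symmetric] D_def[symmetric] distrib_right by linarith
qed

lemma prob_abs_deviation_gt_le:
  assumes A: "good \<Xi> \<in> sets N"
    and B: "AE x in N. \<forall>i\<in>{1..n}. \<forall>t\<in>space \<rho>. sq_err (del i x) t \<le> B"
    and \<epsilon>: "\<epsilon> \<ge> (1 - measure N (good \<Xi>)) * (B + C1\<^sup>2)"
  shows "measure N {x\<in>space N. \<bar>deviation x\<bar> > \<epsilon>} \<le> (1 - measure N (good \<Xi>)) +
     2 * exp (- (2 * (\<epsilon> - (1 - measure N (good \<Xi>)) * (B + C1\<^sup>2))\<^sup>2 / (real n * (C1\<^sup>2 / real n + 4 * C1 * C2)\<^sup>2)))"
proof -
  let ?c = "C1\<^sup>2 / real n + 4 * C1 * C2"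
  have c: "?c > 0"
    using C1 C2 n_pos by (intro add_pos_pos) auto
  have "measure N {x\<in>space N. \<bar>deviation x\<bar> > \<epsilon>} \<le> (1 - measure N (good \<Xi>)) +
     2 * exp (- (2 * (\<epsilon> - (1 - measure N (good \<Xi>)) * (B + C1\<^sup>2))\<^sup>2 / (\<Sum>i=1..n. ?c\<^sup>2)))"
  proof (rule prob_abs_gt_le_of_bounded_differences_on)
    show "AE x in N. \<bar>deviation x\<bar> \<le> B"
      using B AE_space by eventually_elim (auto intro: abs_deviation_le)
    show "\<bar>deviation x\<bar> \<le> C1\<^sup>2" if "x \<in> good \<Xi>" for x
      using that sq_err_good[OF that] by (intro abs_deviation_le) (auto simp: good_def)
    show "\<bar>deviation x - deviation y\<bar> \<le> (\<Sum>i | i \<in> {1..n} \<and> x i \<noteq> y i. ?c)" if "x \<in> good \<Xi>" "y \<in> good \<Xi>" for x y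
      using deviation_good_diff[OF that] by (simp add: mult.commute)
    show "0 < (\<Sum>i=1..n. ?c\<^sup>2)"
      using c n_pos by simp
  qed (use c A \<epsilon> integral_deviation[OF B] deviation_measurable in \<open>auto intro: prob_space_axioms\<close>)
  then show ?thesis
    by simp
qed

end

end

section \<open>Scales and exponents\<close>

text \<open>With \<open>c\<close> for the difference constant and \<open>w\<close> for this scale,
  \<open>w\<^sup>2 = 2 n c\<^sup>2\<close>; this links the exponent of the tail bound, with
  denominator \<open>n c\<^sup>2\<close>, to quotients by \<open>w\<close>.\<close>

lemma deviation_scale_eq:
  fixes C1 C2 :: real
  assumes "n \<ge> 1"
  shows "sqrt 2 * C1 * (C1 / sqrt (real n) + 4 * sqrt (real n) * C2)
    = sqrt (2 * real n) * (C1\<^sup>2 / real n + 4 * C1 * C2)"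
proof -
  have n: "sqrt (real n) > 0" "real n = (sqrt (real n))\<^sup>2"
    using assms by auto
  have "C1 / sqrt (real n) + 4 * sqrt (real n) * C2 = sqrt (real n) * (C1 / real n + 4 * C2)"
    by (subst (3) n(2)) (use n(1) in \<open>simp add: field_simps power2_eq_square\<close>)
  then show ?thesis
    by (simp add: real_sqrt_mult algebra_simps power2_eq_square)
qed

text \<open>For \<open>n \<ge> 3\<close> and \<open>C2 \<le> 2 * C1\<close> the difference constant
  is at most \<open>(1/3 + 8) C1\<^sup>2 = 25/3 C1\<^sup>2\<close>. The constant 12 then suffices
  because \<open>25 sqrt 2 \<le> 36\<close>, that is, \<open>1250 \<le> 1296\<close>.\<close>

lemma deviation_scale_le:
  fixes C1 C2 :: real
  assumes n: "n \<ge> 3" and "C1 > 0" "C2 > 0" "C2 \<le> 2 * C1"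
  shows "sqrt 2 * C1 * (C1 / sqrt (real n) + 4 * sqrt (real n) * C2) \<le> 12 * sqrt (real n) * C1\<^sup>2"
proof -
  have "(sqrt 2 * 25)\<^sup>2 \<le> 36\<^sup>2"
    by (simp add: power_mult_distrib)
  then have s2: "sqrt 2 * 25 \<le> 36"
    by (rule power2_le_imp_le) simp
  have "sqrt (real n) * (C1\<^sup>2 / real n + 4 * C1 * C2) \<le> sqrt (real n) * (C1\<^sup>2 / 3 + 4 * C1 * (2 * C1))"
    using assms by (intro mult_left_mono add_mono divide_left_mono) auto
  then have "sqrt 2 * (sqrt (real n) * (C1\<^sup>2 / real n + 4 * C1 * C2))
      \<le> sqrt 2 * (sqrt (real n) * (C1\<^sup>2 / 3 + 4 * C1 * (2 * C1)))"
    by (rule mult_left_mono) simp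
  also have "\<dots> = (sqrt 2 * 25) * (sqrt (real n) * C1\<^sup>2 / 3)"
    by (simp add: algebra_simps power2_eq_square)
  also have "\<dots> \<le> 36 * (sqrt (real n) * C1\<^sup>2 / 3)"
    by (intro mult_right_mono s2) auto
  finally show ?thesis
    using n by (subst deviation_scale_eq) (simp_all add: real_sqrt_mult mult.assoc)
qed

text \<open>Half of \<epsilon> absorbs \<open>\<gamma> * B\<close>, and
  \<open>C1\<^sup>2 \<le> n c\<close>, so at least \<open>\<epsilon> / 2 - \<gamma> n c\<close> is
  left, which is nonnegative. Twice this, divided by \<open>w\<close>, is the bracket on the
  left.\<close>

lemma exponent_ge:
  fixes C1 C2 \<gamma> B \<epsilon> :: real and n :: nat
  defines "c \<equiv> C1\<^sup>2 / real n + 4 * C1 * C2"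
  defines "w \<equiv> sqrt (2 * real n) * c"
  assumes n: "n \<ge> 1" and C: "C1 > 0" "C2 > 0" and \<gamma>: "\<gamma> \<ge> 0"
    and \<epsilon>K: "2 * \<gamma> * (real n * c) \<le> \<epsilon>" and \<epsilon>B: "2 * \<gamma> * B \<le> \<epsilon>"
  shows "\<gamma> * (B + C1\<^sup>2) \<le> \<epsilon>"
    and "(\<epsilon> / w - sqrt (2 * real n) * \<gamma>)\<^sup>2 \<le> 2 * (\<epsilon> - \<gamma> * (B + C1\<^sup>2))\<^sup>2 / (real n * c\<^sup>2)"
proof -
  have c: "c > 0"
    unfolding c_def using C n by (intro add_pos_pos) auto
  have "C1\<^sup>2 \<le> real n * c"
    using n C by (simp add: c_def distrib_left)
  then have "\<gamma> * C1\<^sup>2 \<le> \<gamma> * (real n * c)"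
    using \<gamma> by (rule mult_left_mono)
  then have 1: "\<epsilon> / 2 - \<gamma> * (real n * c) \<le> \<epsilon> - \<gamma> * (B + C1\<^sup>2)"
    using \<epsilon>B by (simp add: distrib_left)
  have 0: "0 \<le> \<epsilon> / 2 - \<gamma> * (real n * c)"
    using \<epsilon>K by simp
  show "\<gamma> * (B + C1\<^sup>2) \<le> \<epsilon>"
    using 0 1 by linarith
  have w2: "w\<^sup>2 = 2 * real n * c\<^sup>2"
    by (simp add: w_def power_mult_distrib)
  have w: "w > 0"
    using n c by (simp add: w_def)
  have "sqrt (2 * real n) * w = 2 * (real n * c)"
    by (simp add: w_def mult.assoc[symmetric])
  then have "\<epsilon> / w - sqrt (2 * real n) * \<gamma> = 2 * (\<epsilon> / 2 - \<gamma> * (real n * c)) / w"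
    using w by (simp add: field_simps)
  then have "(\<epsilon> / w - sqrt (2 * real n) * \<gamma>)\<^sup>2 = 2 * (\<epsilon> / 2 - \<gamma> * (real n * c))\<^sup>2 / (real n * c\<^sup>2)"
    by (simp only: power_divide power_mult_distrib w2) simp
  also have "\<dots> \<le> 2 * (\<epsilon> - \<gamma> * (B + C1\<^sup>2))\<^sup>2 / (real n * c\<^sup>2)"
    using 0 1 by (intro divide_right_mono mult_left_mono power_mono) auto
  finally show "(\<epsilon> / w - sqrt (2 * real n) * \<gamma>)\<^sup>2 \<le> 2 * (\<epsilon> - \<gamma> * (B + C1\<^sup>2))\<^sup>2 / (real n * c\<^sup>2)" .
qed

lemma exp_neg_square_le:
  fixes \<delta> u :: real
  assumes "0 < \<delta>" "\<delta> \<le> 1" "sqrt (- ln \<delta>) \<le> u"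
  shows "exp (- u\<^sup>2) \<le> \<delta>"
proof -
  have "(sqrt (- ln \<delta>))\<^sup>2 \<le> u\<^sup>2"
    using assms by (intro power_mono) auto
  then have "- u\<^sup>2 \<le> ln \<delta>"
    using assms by simp
  then show ?thesis
    using assms(1) by (metis exp_le_cancel_iff exp_ln)
qed

section \<open>Transfer to the random nodes and the final bounds\<close>

text \<open>The suprema \<open>M\<close> and \<open>F\<close> may be infinite, hence the products in
  \<open>ennreal\<close>, where zero times infinity is zero. The comparison of the two exponentials
  concerns squares of brackets, the second of which may be negative; its premise bounds that bracket
  below by the negative of the first, so that the squares are ordered.\<close>

theorem theorem3p8:
  fixes \<rho> :: "'a measure" and P :: "'w measure" and X :: "nat \<Rightarrow> 'w \<Rightarrow> 'a"
    and Y :: "complex set" and f :: "'a \<Rightarrow> complex"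
    and R :: "('h, 'a) reconstruction" and h :: 'h
    and n :: nat and C1 C2 \<gamma> :: real and M F :: ennreal
    and \<Xi> :: "(nat \<Rightarrow> 'a \<times> complex) set"
    and Z :: "'w \<Rightarrow> nat \<Rightarrow> 'a \<times> complex" and D :: "'w \<Rightarrow> real"
  assumes "prob_space \<rho>" and "prob_space P" and "n \<ge> 1"
    and "f \<in> space \<rho> \<rightarrow> Y" and "f \<in> borel_measurable \<rho>"
    and "\<And>zs. length zs = n - 1 \<Longrightarrow> set zs \<subseteq> space \<rho> \<times> Y \<Longrightarrow> R h zs \<in> space \<rho> \<rightarrow> Y"
    and R_measurable: "(\<lambda>(x, t). R h (map (\<lambda>i. (x i, f (x i))) [1..<n]) t)
           \<in> borel_measurable ((\<Pi>\<^sub>M i\<in>{1..<n}. \<rho>) \<Otimes>\<^sub>M \<rho>)"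
    and X_indep: "prob_space.indep_vars P (\<lambda>_. \<rho>) X {1..n}"
    and X_distr: "\<And>i. i \<in> {1..n} \<Longrightarrow> distr P \<rho> (X i) = \<rho>"
    and Z_eq: "\<And>\<omega>. Z \<omega> = graph_sample f n (\<lambda>i. X i \<omega>)"
    and "C1 > 0" and "C2 > 0" and "C2 \<le> 2 * C1"
    and "admissible (space \<rho>) Y f R n h C1 C2 \<Xi>"
    and Xi_measurable: "{x \<in> space (\<Pi>\<^sub>M i\<in>{1..n}. \<rho>). graph_sample f n x \<in> \<Xi>} \<in> sets (\<Pi>\<^sub>M i\<in>{1..n}. \<rho>)"
    and M_eq: "M = recon_bound (space \<rho>) f R n h"
    and F_eq: "F = sup_norm (space \<rho>) f"
    and \<gamma>_eq: "\<gamma> = 1 - \<P>(\<omega> in P. Z \<omega> \<in> \<Xi>)"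
    and D_eq: "\<And>\<omega>. D \<omega> = \<bar>cv_score f R n (Z \<omega>) h - risk \<rho> f (R h (leave_out n (Z \<omega>) 1))\<bar>"
  shows
    "(\<forall>\<epsilon>::real.
        2 * ennreal \<gamma> * max (ennreal (4 * real n * C1 * C2 + C1\<^sup>2)) ((M + F)\<^sup>2) < ennreal \<epsilon> \<longrightarrow>
        \<P>(\<omega> in P. D \<omega> > \<epsilon>)
          \<le> 2 * \<gamma> + 2 * exp (- (\<epsilon> / (sqrt 2 * C1 * (C1 / sqrt (real n) + 4 * sqrt (real n) * C2))
                                 - sqrt (2 * real n) * \<gamma>)\<^sup>2) \<and>
        (n \<ge> 3 \<and>
         - (\<epsilon> / (12 * sqrt (real n) * C1\<^sup>2) - sqrt (2 * real n) * \<gamma>)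
           \<le> \<epsilon> / (sqrt 2 * C1 * (C1 / sqrt (real n) + 4 * sqrt (real n) * C2)) - sqrt (2 * real n) * \<gamma> \<longrightarrow>
         2 * \<gamma> + 2 * exp (- (\<epsilon> / (sqrt 2 * C1 * (C1 / sqrt (real n) + 4 * sqrt (real n) * C2))
                                 - sqrt (2 * real n) * \<gamma>)\<^sup>2)
          \<le> 2 * \<gamma> + 2 * exp (- (\<epsilon> / (12 * sqrt (real n) * C1\<^sup>2) - sqrt (2 * real n) * \<gamma>)\<^sup>2)))
     \<and>
     (\<forall>\<delta>::real. 0 < \<delta> \<and> \<delta> \<le> 1 \<longrightarrow>
        \<P>(\<omega> in P. ennreal (D \<omega>)
             \<le> max (2 * ennreal \<gamma> * (M + F)\<^sup>2)
                   (ennreal (sqrt 2 * C1 * (C1 / sqrt (real n) + 4 * sqrt (real n) * C2)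
                               * (sqrt (2 * real n) * \<gamma> + sqrt (- ln \<delta>)))))
          > 1 - 2 * (\<gamma> + \<delta>) \<and>
        (n \<ge> 3 \<longrightarrow>
           max (2 * ennreal \<gamma> * (M + F)\<^sup>2)
               (ennreal (sqrt 2 * C1 * (C1 / sqrt (real n) + 4 * sqrt (real n) * C2)
                           * (sqrt (2 * real n) * \<gamma> + sqrt (- ln \<delta>))))
           \<le> max (2 * ennreal \<gamma> * (M + F)\<^sup>2)
                 (ennreal (12 * sqrt (real n) * C1\<^sup>2 * (sqrt (2 * real n) * \<gamma> + sqrt (- ln \<delta>))))))"
proof -
  interpret cross_validation \<rho> f R h n
    by (intro cross_validation.intro cross_validation_axioms.intro) fact+
  interpret P: prob_space P
    by fact
  define c where "c = C1\<^sup>2 / real n + 4 * C1 * C2"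
  define w where "w = sqrt 2 * C1 * (C1 / sqrt (real n) + 4 * sqrt (real n) * C2)"
  define A where "A = good \<Xi>"
  define V where "V \<omega> = (\<lambda>i\<in>{1..n}. X i \<omega>)" for \<omega>
  note C = \<open>C1 > 0\<close> \<open>C2 > 0\<close> and adm = \<open>admissible (space \<rho>) Y f R n h C1 C2 \<Xi>\<close>
  have A_sets[measurable]: "A \<in> sets N"
    using Xi_measurable by (simp add: A_def good_def)
  have X_meas: "X i \<in> P \<rightarrow>\<^sub>M \<rho>" if "i \<in> {1..n}" for i
    using X_indep that by (simp add: P.indep_vars_def)
  have V_meas[measurable]: "V \<in> P \<rightarrow>\<^sub>M N"
    unfolding V_def using X_meas by (intro measurable_restrict) auto
  \<comment> \<open>Independence and the common law make \<open>N\<close> the law of the nodes, so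
    probabilities under \<open>P\<close> become measures under \<open>N\<close>.\<close>
  have V_distr: "distr P N V = N"
  proof -
    have "distr P N V = (\<Pi>\<^sub>M i\<in>{1..n}. distr P \<rho> (X i))"
      unfolding V_def[abs_def]
      using X_indep \<open>n \<ge> 1\<close> X_meas by (subst (asm) P.indep_vars_iff_distr_eq_PiM') auto
    also have "\<dots> = N"
      using X_distr by (intro PiM_cong) auto
    finally show ?thesis .
  qed
  have prob_V: "P.prob {\<omega> \<in> space P. V \<omega> \<in> S} = measure N S" if "S \<in> sets N" for S
    using measure_distr[OF V_meas that] unfolding V_distr by (simp add: vimage_def Int_def conj_commute)
  have Z_V: "Z \<omega> = graph_sample f n (V \<omega>)" for \<omega>
    by (auto simp: Z_eq V_def graph_sample_def)
  have \<gamma>: "\<gamma> = 1 - measure N A"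
  proof -
    have "{\<omega> \<in> space P. Z \<omega> \<in> \<Xi>} = {\<omega> \<in> space P. V \<omega> \<in> A}"
      using measurable_space[OF V_meas] by (auto simp: Z_V A_def good_def)
    then show ?thesis
      using prob_V[OF A_sets] by (simp add: \<gamma>_eq)
  qed
  then have \<gamma>0: "\<gamma> \<ge> 0"
    using N.prob_le_1[of A] by linarith
  have D_V: "D \<omega> = \<bar>deviation (V \<omega>)\<bar>" for \<omega>
    by (simp add: D_eq deviation_def Z_V)
  have D_meas[measurable]: "D \<in> borel_measurable P"
    unfolding D_V[abs_def] using measurable_compose[OF V_meas deviation_measurable] by measurable
  have tail: "\<P>(\<omega> in P. D \<omega> > \<epsilon>)
      \<le> \<gamma> + 2 * exp (- (2 * (\<epsilon> - \<gamma> * (B + C1\<^sup>2))\<^sup>2 / (real n * c\<^sup>2)))"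
    if "AE x in N. \<forall>i\<in>{1..n}. \<forall>t\<in>space \<rho>. sq_err (del i x) t \<le> B" "\<gamma> * (B + C1\<^sup>2) \<le> \<epsilon>" for \<epsilon> B
  proof -
    have sets: "{x \<in> space N. \<bar>deviation x\<bar> > \<epsilon>} \<in> sets N"
      using deviation_measurable by measurable
    have "{\<omega> \<in> space P. D \<omega> > \<epsilon>} = {\<omega> \<in> space P. V \<omega> \<in> {x \<in> space N. \<bar>deviation x\<bar> > \<epsilon>}}"
      using measurable_space[OF V_meas] by (auto simp: D_V)
    then have "\<P>(\<omega> in P. D \<omega> > \<epsilon>) = measure N {x \<in> space N. \<bar>deviation x\<bar> > \<epsilon>}"
      by (simp only: prob_V[OF sets])
    then show ?thesis
      using prob_abs_deviation_gt_le[OF C adm A_sets[unfolded A_def] that(1), of \<epsilon>] that(2)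
      by (simp add: \<gamma> A_def c_def)
  qed
  \<comment> \<open>For \<open>\<gamma> = 0\<close> and \<open>M + F = \<infinity>\<close> the product \<open>\<gamma> (M + F)\<^sup>2\<close> is \<open>0\<close>, and \<open>C1\<^sup>2\<close> is an almost sure bound instead.\<close>
  have bound: "(\<exists>B\<ge>0. (AE x in N. \<forall>i\<in>{1..n}. \<forall>t\<in>space \<rho>. sq_err (del i x) t \<le> B) \<and>
      2 * ennreal \<gamma> * (M + F)\<^sup>2 = ennreal (2 * \<gamma> * B)) \<or> 2 * ennreal \<gamma> * (M + F)\<^sup>2 = top"
  proof (cases "\<gamma> = 0")
    case True
    then have "AE x in N. x \<in> A"
      using N.prob_eq_1[OF A_sets] by (simp add: \<gamma>)
    then have "AE x in N. \<forall>i\<in>{1..n}. \<forall>t\<in>space \<rho>. sq_err (del i x) t \<le> C1\<^sup>2"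
      by eventually_elim (auto simp: A_def intro: sq_err_good[OF C adm])
    moreover have "2 * ennreal \<gamma> * (M + F)\<^sup>2 = ennreal (2 * \<gamma> * C1\<^sup>2)"
      using True by simp
    ultimately show ?thesis
      by (intro disjI1 exI[of _ "C1\<^sup>2"]) simp
  next
    case False
    show ?thesis
    proof (cases "M + F = top")
      case True
      \<comment> \<open>With \<gamma> positive the product is infinite: no real \<epsilon> exceeds
        it, and the high-probability bound is trivial.\<close>
      have "2 * ennreal \<gamma> \<noteq> 0"
        using False \<gamma>0 by simp
      then have "2 * ennreal \<gamma> * (M + F)\<^sup>2 = top"
        unfolding True power2_eq_square by (simp add: ennreal_mult_top)
      then show ?thesis
        by (rule disjI2)
    next
      case fin: False
      define m where "m = enn2real (M + F)"
      have m: "M + F = ennreal m" "m \<ge> 0"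
        using fin by (simp_all add: m_def less_top)
      have "sq_err (del i x) t \<le> m\<^sup>2" if "x \<in> space N" "i \<in> {1..n}" "t \<in> space \<rho>" for x i t
      proof -
        define xs where "xs = map (del i x) [1..<n]"
        define r where "r = R h (map (\<lambda>x. (x, f x)) xs) t"
        have "xs \<in> {xs. length xs = n - 1 \<and> set xs \<subseteq> space \<rho>}"
          using del_space[OF that(1,2)] by (auto simp: xs_def space_PiM)
        then have "sup_norm (space \<rho>) (R h (map (\<lambda>x. (x, f x)) xs)) \<le> M"
          unfolding M_eq recon_bound_def by (rule SUP_upper)
        moreover have "ennreal (cmod r) \<le> sup_norm (space \<rho>) (R h (map (\<lambda>x. (x, f x)) xs))"
          unfolding sup_norm_def r_def using that(3) by (rule SUP_upper)
        moreover have "ennreal (cmod (f t)) \<le> F"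
          unfolding F_eq sup_norm_def using that(3) by (rule SUP_upper)
        ultimately have "ennreal (cmod r) + ennreal (cmod (f t)) \<le> M + F"
          by (meson add_mono order_trans)
        then have "cmod r + cmod (f t) \<le> m"
          by (simp add: m ennreal_plus[symmetric] del: ennreal_plus)
        then have "cmod (r - f t) \<le> m"
          using norm_triangle_ineq4[of r "f t"] by linarith
        moreover have "sq_err (del i x) t = (cmod (r - f t))\<^sup>2"
          by (simp add: sq_err_def r_def xs_def comp_def)
        ultimately show ?thesis
          by (simp add: power_mono)
      qed
      then have "AE x in N. \<forall>i\<in>{1..n}. \<forall>t\<in>space \<rho>. sq_err (del i x) t \<le> m\<^sup>2"
        by (intro AE_I2) blast
      moreover have "2 * ennreal \<gamma> * (M + F)\<^sup>2 = ennreal (2 * \<gamma> * m\<^sup>2)"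
        using \<gamma>0 m by (simp add: ennreal_mult ennreal_power)
      ultimately show ?thesis
        by (intro disjI1 exI[of _ "m\<^sup>2"]) simp
    qed
  qed
  have c: "c > 0"
    unfolding c_def using C \<open>n \<ge> 1\<close> by (intro add_pos_pos) auto
  have w_eq: "w = sqrt (2 * real n) * c"
    unfolding w_def c_def by (rule deviation_scale_eq) fact
  have w: "w > 0"
    using c \<open>n \<ge> 1\<close> by (simp add: w_eq)
  \<comment> \<open>The first entry of the maximum in the threshold for \<epsilon> is
    \<open>n c\<close>, as in the hypothesis of \<open>exponent_ge\<close>.\<close>
  have K: "4 * real n * C1 * C2 + C1\<^sup>2 = real n * c"
    using \<open>n \<ge> 1\<close> by (simp add: c_def distrib_left)
  have w_le: "w \<le> 12 * sqrt (real n) * C1\<^sup>2" if "n \<ge> 3"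
    unfolding w_def by (rule deviation_scale_le) fact+
  note exponent = exponent_ge[OF \<open>n \<ge> 1\<close> C \<gamma>0, folded c_def, folded w_eq]

  show ?thesis
    unfolding w_def[symmetric] K
  proof (intro conjI allI impI; (elim conjE)?)
    fix \<epsilon> :: real
    assume "2 * ennreal \<gamma> * max (ennreal (real n * c)) ((M + F)\<^sup>2) < ennreal \<epsilon>"
    moreover have "2 * ennreal \<gamma> * ennreal (real n * c) \<le> 2 * ennreal \<gamma> * max (ennreal (real n * c)) ((M + F)\<^sup>2)"
      "2 * ennreal \<gamma> * (M + F)\<^sup>2 \<le> 2 * ennreal \<gamma> * max (ennreal (real n * c)) ((M + F)\<^sup>2)"
      by (intro mult_left_mono; simp)+
    ultimately have less: "2 * ennreal \<gamma> * ennreal (real n * c) < ennreal \<epsilon>"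
        "2 * ennreal \<gamma> * (M + F)\<^sup>2 < ennreal \<epsilon>"
      by (auto elim: le_less_trans)
    have less_K: "2 * \<gamma> * (real n * c) < \<epsilon>"
      using less(1) \<gamma>0 c by (simp add: ennreal_mult''[symmetric] ennreal_less_iff flip: ennreal_numeral)
    then have \<epsilon>0: "\<epsilon> \<ge> 0"
      using \<gamma>0 c by (smt (verit) mult_nonneg_nonneg of_nat_0_le_iff)
    have "2 * ennreal \<gamma> * (M + F)\<^sup>2 \<noteq> top"
      using less(2) by auto
    then obtain B where B: "AE x in N. \<forall>i\<in>{1..n}. \<forall>t\<in>space \<rho>. sq_err (del i x) t \<le> B"
      and "B \<ge> 0" "2 * ennreal \<gamma> * (M + F)\<^sup>2 = ennreal (2 * \<gamma> * B)"
      using bound by blast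
    then have less_B: "2 * \<gamma> * B < \<epsilon>"
      using less(2) \<gamma>0 by (simp add: ennreal_less_iff)
    note ex = exponent[OF less_imp_le[OF less_K] less_imp_le[OF less_B]]
    have "\<P>(\<omega> in P. D \<omega> > \<epsilon>)
        \<le> \<gamma> + 2 * exp (- (2 * (\<epsilon> - \<gamma> * (B + C1\<^sup>2))\<^sup>2 / (real n * c\<^sup>2)))"
      by (rule tail[OF B ex(1)])
    also have "\<dots> \<le> 2 * \<gamma> + 2 * exp (- (\<epsilon> / w - sqrt (2 * real n) * \<gamma>)\<^sup>2)"
      using ex(2) \<gamma>0 by (intro add_mono mult_left_mono) auto
    finally show "\<P>(\<omega> in P. D \<omega> > \<epsilon>) \<le> 2 * \<gamma> + 2 * exp (- (\<epsilon> / w - sqrt (2 * real n) * \<gamma>)\<^sup>2)" .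
    assume "n \<ge> 3" and neg: "- (\<epsilon> / (12 * sqrt (real n) * C1\<^sup>2) - sqrt (2 * real n) * \<gamma>)
        \<le> \<epsilon> / w - sqrt (2 * real n) * \<gamma>"
    \<comment> \<open>The larger denominator puts this bracket below the other one, and
      \<open>neg\<close> puts it above the negative of the other; hence the moduli and the squares
      are ordered.\<close>
    have "\<epsilon> / (12 * sqrt (real n) * C1\<^sup>2) \<le> \<epsilon> / w"
      using w_le[OF \<open>n \<ge> 3\<close>] \<epsilon>0 w by (intro divide_left_mono) auto
    then have "\<bar>\<epsilon> / (12 * sqrt (real n) * C1\<^sup>2) - sqrt (2 * real n) * \<gamma>\<bar> \<le> \<epsilon> / w - sqrt (2 * real n) * \<gamma>"
      using neg by linarith
    then have "(\<epsilon> / (12 * sqrt (real n) * C1\<^sup>2) - sqrt (2 * real n) * \<gamma>)\<^sup>2 \<le> (\<epsilon> / w - sqrt (2 * real n) * \<gamma>)\<^sup>2"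
      using power_mono[of "\<bar>_\<bar>" _ 2] by fastforce
    then show "2 * \<gamma> + 2 * exp (- (\<epsilon> / w - sqrt (2 * real n) * \<gamma>)\<^sup>2)
        \<le> 2 * \<gamma> + 2 * exp (- (\<epsilon> / (12 * sqrt (real n) * C1\<^sup>2) - sqrt (2 * real n) * \<gamma>)\<^sup>2)"
      by simp
  next
    fix \<delta> :: real
    assume \<delta>: "0 < \<delta>" "\<delta> \<le> 1"
    define t where "t = w * (sqrt (2 * real n) * \<gamma> + sqrt (- ln \<delta>))"
    have t0: "t \<ge> 0"
      using w \<gamma>0 \<delta> by (simp add: t_def)
    have "\<P>(\<omega> in P. ennreal (D \<omega>) \<le> max (2 * ennreal \<gamma> * (M + F)\<^sup>2) (ennreal t)) > 1 - 2 * (\<gamma> + \<delta>)"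
    proof (cases "2 * ennreal \<gamma> * (M + F)\<^sup>2 = top")
      case True
      then show ?thesis
        using \<gamma>0 \<delta> by (simp add: P.prob_space)
    next
      case False
      then obtain B where B: "AE x in N. \<forall>i\<in>{1..n}. \<forall>t\<in>space \<rho>. sq_err (del i x) t \<le> B"
        and B0: "B \<ge> 0" and B_eq: "2 * ennreal \<gamma> * (M + F)\<^sup>2 = ennreal (2 * \<gamma> * B)"
        using bound by blast
      \<comment> \<open>The maximum in the claim, as a real number. It may equal a threshold of the
        first part, where a strict inequality is assumed, so the argument returns to
        \<open>exponent_ge\<close> and \<open>tail\<close>.\<close>
      define \<epsilon> where "\<epsilon> = max (2 * \<gamma> * B) t"
      have \<epsilon>0: "\<epsilon> \<ge> 0"
        using t0 by (simp add: \<epsilon>_def)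
      have "sqrt (2 * real n) * w = 2 * (real n * c)"
        by (simp add: w_eq mult.assoc[symmetric])
      then have t_eq: "t = 2 * \<gamma> * (real n * c) + w * sqrt (- ln \<delta>)"
        by (simp add: t_def algebra_simps)
      then have "2 * \<gamma> * (real n * c) \<le> \<epsilon>"
        using w \<delta> by (simp add: \<epsilon>_def le_max_iff_disj)
      note ex = exponent[OF this, of B]
      have \<epsilon>B: "2 * \<gamma> * B \<le> \<epsilon>"
        by (simp add: \<epsilon>_def)
      have "t / w \<le> \<epsilon> / w"
        using w by (intro divide_right_mono) (auto simp: \<epsilon>_def)
      \<comment> \<open>The number \<open>t\<close> is the \<epsilon> at which the bracket equals
        \<open>sqrt (- ln \<delta>)\<close>; a larger \<epsilon> only increases it.\<close>
      then have root_le: "sqrt (- ln \<delta>) \<le> \<epsilon> / w - sqrt (2 * real n) * \<gamma>"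
        using w by (simp add: t_def)
      \<comment> \<open>Strictness: if \<open>\<gamma> > 0\<close>, the tail bound has only one \<open>\<gamma>\<close>; if \<open>\<gamma> = 0\<close>, it is \<open>2 \<delta>\<^sup>4\<close>.\<close>
      have "\<P>(\<omega> in P. D \<omega> > \<epsilon>) < 2 * (\<gamma> + \<delta>)"
      proof (cases "\<gamma> = 0")
        case False
        have "\<P>(\<omega> in P. D \<omega> > \<epsilon>)
            \<le> \<gamma> + 2 * exp (- (2 * (\<epsilon> - \<gamma> * (B + C1\<^sup>2))\<^sup>2 / (real n * c\<^sup>2)))"
          by (rule tail[OF B ex(1)[OF \<epsilon>B]])
        also have "\<dots> \<le> \<gamma> + 2 * exp (- (\<epsilon> / w - sqrt (2 * real n) * \<gamma>)\<^sup>2)"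
          using ex(2)[OF \<epsilon>B] by simp
        also have "\<dots> \<le> \<gamma> + 2 * \<delta>"
          using exp_neg_square_le[OF \<delta> root_le] by simp
        finally show ?thesis
          using False \<gamma>0 by simp
      next
        case True
        show ?thesis
        \<comment> \<open>At \<open>\<delta> = 1\<close> the logarithm vanishes and gives no strict
          gain, but \<open>2 * \<delta>\<close> already exceeds every probability.\<close>
        proof (cases "\<delta> = 1")
          case True
          have "\<P>(\<omega> in P. D \<omega> > \<epsilon>) \<le> 1"
            by (rule P.prob_le_1)
          then show ?thesis
            using True \<gamma>0 by argo
        next
          case False
          \<comment> \<open>With \<gamma> zero nothing is subtracted from \<epsilon>, so the
            exponent in \<open>tail\<close> is \<open>- 4 (\<epsilon> / w)\<^sup>2\<close>, at most
            \<open>4 ln \<delta>\<close>, which is below \<open>ln \<delta>\<close> because the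
            logarithm is negative.\<close>
          then have ln: "ln \<delta> < 0"
            using \<delta> by simp
          have "w\<^sup>2 = 2 * (real n * c\<^sup>2)"
            by (simp add: w_eq power_mult_distrib)
          then have "2 * \<epsilon>\<^sup>2 / (real n * c\<^sup>2) = 4 * (\<epsilon> / w)\<^sup>2"
            by (simp add: power_divide)
          moreover have "(sqrt (- ln \<delta>))\<^sup>2 \<le> (\<epsilon> / w)\<^sup>2"
            using root_le True ln by (intro power_mono) auto
          ultimately have "- (2 * \<epsilon>\<^sup>2 / (real n * c\<^sup>2)) < ln \<delta>"
            using ln by simp
          then have "exp (- (2 * \<epsilon>\<^sup>2 / (real n * c\<^sup>2))) < \<delta>"
            using \<delta>(1) by (metis exp_less_cancel_iff exp_ln)
          then show ?thesis
            using tail[OF B, of \<epsilon>] True \<epsilon>0 by simp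
        qed
      qed
      moreover have "\<P>(\<omega> in P. ennreal (D \<omega>) \<le> max (2 * ennreal \<gamma> * (M + F)\<^sup>2) (ennreal t))
          = 1 - \<P>(\<omega> in P. D \<omega> > \<epsilon>)"
      proof -
        have "max (2 * ennreal \<gamma> * (M + F)\<^sup>2) (ennreal t) = ennreal \<epsilon>"
          unfolding B_eq \<epsilon>_def using B0 \<gamma>0 t0 by (simp add: ennreal_max_0 max_def ennreal_le_iff)
        then have "{\<omega> \<in> space P. ennreal (D \<omega>) \<le> max (2 * ennreal \<gamma> * (M + F)\<^sup>2) (ennreal t)}
            = space P - {\<omega> \<in> space P. D \<omega> > \<epsilon>}"
          using \<epsilon>0 by (auto simp: ennreal_le_iff)
        moreover have "{\<omega> \<in> space P. D \<omega> > \<epsilon>} \<in> sets P"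
          by measurable
        ultimately show ?thesis
          by (simp add: P.prob_compl)
      qed
      ultimately show ?thesis
        by simp
    qed
    then show "\<P>(\<omega> in P. ennreal (D \<omega>) \<le> max (2 * ennreal \<gamma> * (M + F)\<^sup>2)
        (ennreal (w * (sqrt (2 * real n) * \<gamma> + sqrt (- ln \<delta>))))) > 1 - 2 * (\<gamma> + \<delta>)"
      unfolding t_def .
    assume "n \<ge> 3"
    have "w * (sqrt (2 * real n) * \<gamma> + sqrt (- ln \<delta>))
        \<le> 12 * sqrt (real n) * C1\<^sup>2 * (sqrt (2 * real n) * \<gamma> + sqrt (- ln \<delta>))"
      using w_le[OF \<open>n \<ge> 3\<close>] \<gamma>0 \<delta> by (intro mult_right_mono) auto
    then show "max (2 * ennreal \<gamma> * (M + F)\<^sup>2) (ennreal (w * (sqrt (2 * real n) * \<gamma> + sqrt (- ln \<delta>))))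
        \<le> max (2 * ennreal \<gamma> * (M + F)\<^sup>2)
            (ennreal (12 * sqrt (real n) * C1\<^sup>2 * (sqrt (2 * real n) * \<gamma> + sqrt (- ln \<delta>))))"
      by (intro max.mono ennreal_leI order_refl)
  qed
qed

end
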